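(* Every $3$-regular graph $G$ having a MED decomposition is $(7,2)$-edge-choosable.
   Context: A double-star is a $6$-vertex tree having two adjacent vertices of degree $3$. A subgraph $F$ of $G$ consists of independent double-stars if its components are pairwise vertex-disjoint double-stars and the set of all leaves of components of $F$ is an independent set of vertices in $G$. A MED decomposition of $G$ is a partition of $E(G)$ into subgraphs $G_1,G_2,G_3$ where $G_1$ is a matching, every component of $G_2$ is an even cycle, and $G_3$ consists of independent double-stars. A graph is $(r,s)$-edge-choosable if for every assignment of lists of size $r$ to its edges, one can choose $s$ colors from each edge's list so that incident edges receive disjoint sets. *)

theory Defs
  imports Main
begin

text \<open>
  A graph is a pair of a vertex set and a set of edges, each edge being the set of its two ends.
  The predicate \<open>simple_graph\<close> carries the well-formedness conditions (finite, loopless, no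
  multiple edges).
\<close>

type_synonym 'a graph = "'a set \<times> 'a set set"

abbreviation verts :: "'a graph \<Rightarrow> 'a set" where
  "verts G \<equiv> fst G"

abbreviation edges :: "'a graph \<Rightarrow> 'a set set" where
  "edges G \<equiv> snd G"

definition simple_graph :: "'a graph \<Rightarrow> bool" where
  "simple_graph G \<longleftrightarrow>
     finite (verts G) \<and> (\<forall>e\<in>edges G. e \<subseteq> verts G \<and> card e = 2)"

definition subgraph :: "'a graph \<Rightarrow> 'a graph \<Rightarrow> bool" where
  "subgraph H G \<longleftrightarrow>
     simple_graph H \<and> verts H \<subseteq> verts G \<and> edges H \<subseteq> edges G"

definition vdegree :: "'a graph \<Rightarrow> 'a \<Rightarrow> nat" where
  "vdegree G v = card {e \<in> edges G. v \<in> e}"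

definition regular_graph :: "nat \<Rightarrow> 'a graph \<Rightarrow> bool" where
  "regular_graph k G \<longleftrightarrow> (\<forall>v\<in>verts G. vdegree G v = k)"

definition independent_set :: "'a graph \<Rightarrow> 'a set \<Rightarrow> bool" where
  "independent_set G S \<longleftrightarrow>
     S \<subseteq> verts G \<and> (\<forall>u\<in>S. \<forall>v\<in>S. {u, v} \<notin> edges G)"

definition reachable :: "'a graph \<Rightarrow> 'a \<Rightarrow> 'a \<Rightarrow> bool" where
  "reachable G = (\<lambda>u v. {u, v} \<in> edges G)\<^sup>*\<^sup>*"

definition connected_graph :: "'a graph \<Rightarrow> bool" where
  "connected_graph G \<longleftrightarrow>
     verts G \<noteq> {} \<and> (\<forall>u\<in>verts G. \<forall>v\<in>verts G. reachable G u v)"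

definition induced_subgraph :: "'a graph \<Rightarrow> 'a set \<Rightarrow> 'a graph" where
  "induced_subgraph G W = (W, {e \<in> edges G. e \<subseteq> W})"

definition graph_components :: "'a graph \<Rightarrow> 'a graph set" where
  "graph_components G =
     (\<lambda>u. induced_subgraph G {v \<in> verts G. reachable G u v}) ` verts G"

definition is_cycle :: "'a graph \<Rightarrow> bool" where
  "is_cycle G \<longleftrightarrow>
     (\<exists>vs. 3 \<le> length vs \<and> distinct vs \<and> verts G = set vs \<and>
        edges G = {{vs ! i, vs ! (Suc i mod length vs)} | i. i < length vs})"

definition even_cycle :: "'a graph \<Rightarrow> bool" where
  "even_cycle G \<longleftrightarrow> is_cycle G \<and> even (card (edges G))"

definition is_tree :: "'a graph \<Rightarrow> bool" where
  "is_tree G \<longleftrightarrow>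
     simple_graph G \<and> connected_graph G \<and> \<not> (\<exists>H. subgraph H G \<and> is_cycle H)"

definition double_star :: "'a graph \<Rightarrow> bool" where
  "double_star G \<longleftrightarrow>
     is_tree G \<and> card (verts G) = 6 \<and>
     (\<exists>u\<in>verts G. \<exists>v\<in>verts G.
        {u, v} \<in> edges G \<and> vdegree G u = 3 \<and> vdegree G v = 3)"

definition leaves :: "'a graph \<Rightarrow> 'a set" where
  "leaves G = {v \<in> verts G. vdegree G v = 1}"

text \<open>Distinct components are vertex-disjoint by construction.\<close>

definition independent_double_stars :: "'a graph \<Rightarrow> 'a graph \<Rightarrow> bool" where
  "independent_double_stars G F \<longleftrightarrow>
     (\<forall>K\<in>graph_components F. double_star K) \<and>
     independent_set G (\<Union>K\<in>graph_components F. leaves K)"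

definition is_matching :: "'a graph \<Rightarrow> bool" where
  "is_matching H \<longleftrightarrow>
     (\<forall>e\<in>edges H. \<forall>e'\<in>edges H. e \<noteq> e' \<longrightarrow> e \<inter> e' = {})"

text \<open>The parts of a decomposition may be empty.\<close>

definition MED_decomposition ::
    "'a graph \<Rightarrow> 'a graph \<Rightarrow> 'a graph \<Rightarrow> 'a graph \<Rightarrow> bool" where
  "MED_decomposition G G1 G2 G3 \<longleftrightarrow>
     subgraph G1 G \<and> subgraph G2 G \<and> subgraph G3 G \<and>
     edges G1 \<union> edges G2 \<union> edges G3 = edges G \<and>
     edges G1 \<inter> edges G2 = {} \<and> edges G1 \<inter> edges G3 = {} \<and> edges G2 \<inter> edges G3 = {} \<and>
     is_matching G1 \<and>
     (\<forall>K\<in>graph_components G2. even_cycle K) \<and>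
     independent_double_stars G G3"

text \<open>
  The type argument is the type of colours: HOL cannot quantify over it inside the definition, so
  statements leave it as a type variable.
\<close>

definition edge_choosable :: "'c itself \<Rightarrow> nat \<Rightarrow> nat \<Rightarrow> 'a graph \<Rightarrow> bool" where
  "edge_choosable (_ :: 'c itself) r s G \<longleftrightarrow>
     (\<forall>L :: 'a set \<Rightarrow> 'c set.
        (\<forall>e\<in>edges G. finite (L e) \<and> card (L e) = r) \<longrightarrow>
        (\<exists>f :: 'a set \<Rightarrow> 'c set.
           (\<forall>e\<in>edges G. f e \<subseteq> L e \<and> card (f e) = s) \<and>
           (\<forall>e\<in>edges G. \<forall>e'\<in>edges G.
              e \<noteq> e' \<and> e \<inter> e' \<noteq> {} \<longrightarrow> f e \<inter> f e' = {})))"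

end

theory Submission
  imports Defs
begin

text \<open>
  Every vertex on a cycle of the decomposition has exactly one further edge, which lies in the
  matching or is a pendant edge of a double-star. If these further edges get two colours each so that
  every cycle edge loses at most three of its seven colours, the even cycles can be completed by
  Galvin's kernel argument, because four colours are left on each of their edges.

  A cycle edge loses at most three colours as soon as one colour at one end and one colour at the
  other end coincide or are not both in its list. Such colours are chosen, one per cycle vertex, by
  propagation along the cycle: given the colour at the next vertex, either it can be repeated or,
  lists having equal size, some colour outside the list of the cycle edge is available. A matching
  edge receives the colours of its two ends.

  In each half of a double-star one leaf is late: a colour prescribed for it starts the propagation
  towards it, but it commits to nothing until the matching is coloured. Its two neighbours
  on the cycle are ends of matching edges by independence, and each of its two cycle edges is then
  satisfied by at least two colours of its list. This lets it avoid the single colour forced on its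
  sibling. Prescribing the same colour, or a colour missing from the list of the central edge, for
  the two late leaves of a double-star leaves two colours for the central edge.
\<close>

section \<open>Choices from lists\<close>

text \<open>A cycle edge with list \<open>A\<close> loses at most one colour to the pair \<open>c\<close>, \<open>d\<close>.\<close>

definition compat :: "'c set \<Rightarrow> 'c \<Rightarrow> 'c \<Rightarrow> bool" where
  "compat A c d \<longleftrightarrow> c = d \<or> c \<notin> A \<or> d \<notin> A"

lemma compat_sym: "compat A c d \<longleftrightarrow> compat A d c"
  by (auto simp: compat_def)

lemma ex_mem_diff_of_card_eq:
  assumes "finite A" "finite X" "card X = card A" "X \<noteq> A"
  shows "\<exists>d\<in>X. d \<notin> A"
  using assms card_subset_eq by blast

text \<open>If one of the lists differs from \<open>K\<close>, equal size gives it a colour outside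
  \<open>K\<close>; otherwise both are \<open>K\<close> and share a colour. With \<open>K\<close>
  the list of the central edge, this supplies the colours prescribed for the two late leaves of a
  double-star.\<close>

lemma ex_outside_or_common:
  assumes "0 < m" "card X = m" "card Y = m" "card K = m"
  shows "\<exists>x\<in>X. \<exists>y\<in>Y. x \<notin> K \<or> y \<notin> K \<or> x = y"
proof -
  have fin: "finite X" "finite Y" "finite K" and "X \<noteq> {}" "Y \<noteq> {}"
    using assms card_gt_0_iff by metis+
  then obtain x y where xy: "x \<in> X" "y \<in> Y" by blast
  consider "X \<noteq> K" | "Y \<noteq> K" | "X = Y" by blast
  then show ?thesis
  proof cases
    case 1
    then show ?thesis using ex_mem_diff_of_card_eq[of K X] fin assms xy(2) by metis
  next
    case 2
    then show ?thesis using ex_mem_diff_of_card_eq[of K Y] fin assms xy(1) by metis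
  next
    case 3
    then show ?thesis using xy by blast
  qed
qed

text \<open>One propagation step: \<open>c\<close> is repeated if \<open>X\<close> offers it. If
  \<open>X\<close> does not and \<open>c\<close> lies in \<open>A\<close>, then \<open>X\<close>
  differs from \<open>A\<close> and, having equal size, contains a colour outside
  \<open>A\<close>.\<close>

lemma ex_compat:
  assumes "finite A" "finite X" "card X = card A" "X \<noteq> {}"
  shows "\<exists>d\<in>X. compat A d c"
proof (cases "c \<in> X \<or> c \<notin> A")
  case True
  then show ?thesis using assms(4) unfolding compat_def by blast
next
  case False
  then have "X \<noteq> A" by blast
  then show ?thesis using ex_mem_diff_of_card_eq[OF assms(1-3)] unfolding compat_def by blast
qed

text \<open>A colour of \<open>Z\<close> outside \<open>A\<close> is compatible with all of
  \<open>X\<close>. If there is none and \<open>Z\<close> is nonempty, the compatible colours are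
  those of \<open>X - A\<close> and of \<open>Z \<inter> X\<close>; since \<open>X - A\<close> is as
  large as \<open>A - X\<close>, it makes up for the colours of \<open>Z\<close> missing from
  \<open>X\<close>.\<close>

lemma card_compat_ge:
  assumes "finite A" "finite X" "card X = card A" "card Z \<le> card X"
  shows "card Z \<le> card {c \<in> X. \<exists>d\<in>Z. compat A c d}" (is "_ \<le> card ?F")
proof (cases "Z \<subseteq> A")
  case True
  then have fZ: "finite Z" using assms(1) finite_subset by blast
  show ?thesis
  proof (cases "Z = {}")
    case False
    then have F: "?F = (X - A) \<union> (Z \<inter> X)" using True unfolding compat_def by auto
    have "card (X - A) + card (X \<inter> A) = card X"
      using assms(2) by (metis card_Diff_subset_Int card_mono finite_Int inf_le1 le_add_diff_inverse2)
    moreover have "card (A - X) + card (X \<inter> A) = card A"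
      using assms(1) by (metis card_Diff_subset_Int card_mono finite_Int inf_le1 inf_commute le_add_diff_inverse2)
    ultimately have "card (X - A) = card (A - X)" using assms(3) by linarith
    moreover have "card (Z - X) \<le> card (A - X)" using True assms(1) by (intro card_mono) auto
    moreover have "card Z = card (Z - X) + card (Z \<inter> X)"
      using fZ by (metis card_Int_Diff add.commute)
    moreover have "card ?F = card (X - A) + card (Z \<inter> X)"
      unfolding F using assms True fZ by (intro card_Un_disjoint) auto
    ultimately show ?thesis by linarith
  qed simp
next
  case False
  then have "?F = X" unfolding compat_def by blast
  then show ?thesis using assms by simp
qed

text \<open>The pair \<open>c\<close>, \<open>d\<close> accounts for at most one colour of
  \<open>A\<close>, so at most three of the seven colours are lost. Four is twice the demand of a
  cycle edge, as the completion along even cycles requires.\<close>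

lemma card_remaining_ge_4:
  assumes "card A = 7" "card P = 2" "card Q = 2" "c \<in> P" "d \<in> Q" "compat A c d"
  shows "4 \<le> card (A - (P \<union> Q))"
proof -
  have fin: "finite A" "finite P" "finite Q" using assms by (metis card.infinite zero_neq_numeral)+
  obtain c' d' where P: "P = {c, c'}" and Q: "Q = {d, d'}"
    using assms(2-5) by (metis card_2_iff doubleton_eq_iff insertE singletonD)
  have "\<exists>x y z. A \<inter> (P \<union> Q) \<subseteq> {x, y, z}"
    using assms(6) unfolding P Q compat_def by blast
  then obtain x y z where "A \<inter> (P \<union> Q) \<subseteq> {x, y, z}" by blast
  then have "card (A \<inter> (P \<union> Q)) \<le> card {x, y, z}" by (intro card_mono) auto
  also have "\<dots> \<le> 3" by (simp add: card_insert_if)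
  finally have "card (A \<inter> (P \<union> Q)) \<le> 3" .
  then show ?thesis using assms(1) fin by (simp add: card_Diff_subset_Int)
qed

text \<open>If every colour available for the extension were new in \<open>K\<close>, at least four colours of \<open>K\<close>
  would still be unused, so one more does no harm.\<close>

lemma extend_to_pair:
  assumes X: "card X = 7" and K: "card K = 7"
    and P: "P \<subseteq> X" "P \<noteq> {}" "card P \<le> 2" "P \<subseteq> W" and N: "card N \<le> 2" "finite N" "P \<inter> N = {}"
    and W: "card (K \<inter> W) \<le> 5"
  shows "\<exists>P'. P \<subseteq> P' \<and> P' \<subseteq> X \<and> card P' = 2 \<and> P' \<inter> N = {} \<and> card (K \<inter> (W \<union> P')) \<le> 5"
proof (cases "card P = 2")
  case True
  have "W \<union> P = W" using P(4) by blast
  then show ?thesis using True assms by (intro exI[of _ P]) auto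
next
  case False
  have fin: "finite X" "finite K" using X K by (metis card.infinite zero_neq_numeral)+
  have fP: "finite P" using P(1) fin finite_subset by blast
  then have c1: "card P = 1" using False P(2,3) card_0_eq[OF fP] by linarith
  let ?Av = "X - (P \<union> N)"
  \<comment> \<open>\<open>P\<close> has one colour and \<open>N\<close> at most two, which leaves
    at least 7 - 3 = 4 colours of \<open>X\<close>.\<close>
  have "card (P \<union> N) \<le> 3" using card_Un_le[of P N] c1 N by linarith
  then have av: "4 \<le> card ?Av" using X fP N(2) diff_card_le_card_Diff[of "P \<union> N" X] by simp
  have "\<exists>x\<in>?Av. card (K \<inter> (W \<union> insert x P)) \<le> 5"
  proof (cases "\<exists>x\<in>?Av. x \<notin> K \<or> x \<in> W")
    case True
    then obtain x where x: "x \<in> ?Av" "x \<notin> K \<or> x \<in> W" by blast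
    then have "K \<inter> (W \<union> insert x P) = K \<inter> W" using P(4) by blast
    then show ?thesis using x W by metis
  next
    case False
    then have "?Av \<subseteq> K - K \<inter> W" by blast
    then have "4 \<le> card (K - K \<inter> W)" using av fin by (meson card_mono finite_Diff le_trans)
    then have w: "card (K \<inter> W) \<le> 3" using K fin by (simp add: card_Diff_subset)
    have "?Av \<noteq> {}" using av by (metis card.empty not_numeral_le_zero)
    then obtain x where x: "x \<in> ?Av" by blast
    have "K \<inter> (W \<union> insert x P) \<subseteq> insert x (K \<inter> W)" using P(4) by blast
    then have "card (K \<inter> (W \<union> insert x P)) \<le> card (insert x (K \<inter> W))" using fin by (intro card_mono) auto
    also have "\<dots> \<le> 4" using w by (simp add: card_insert_if fin)
    finally have "card (K \<inter> (W \<union> insert x P)) \<le> 5" by linarith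
    then show ?thesis using x by (rule bexI)
  qed
  then obtain x where x: "x \<in> ?Av" "card (K \<inter> (W \<union> insert x P)) \<le> 5" by blast
  then show ?thesis using c1 fP P(1) N(3) by (intro exI[of _ "insert x P"]) auto
qed

section \<open>Colours committed on a double-star\<close>

text \<open>Here \<open>s\<close> is the colour forced on the sibling of a late leaf, and
  \<open>Fa\<close>, \<open>Fb\<close> hold the late leaf's candidates towards its two cycle
  neighbours. If \<open>r\<close> differs from \<open>s\<close>, then \<open>q = r\<close> works;
  otherwise the sibling already uses \<open>r\<close>. Either way \<open>r\<close> is among the
  committed colours, on which the count at the central edge relies.\<close>

lemma pick_distinct_from:
  assumes "2 \<le> card Fa" "2 \<le> card Fb" "r \<in> Fb"
  shows "\<exists>p q. p \<in> Fa \<and> q \<in> Fb \<and> p \<noteq> s \<and> q \<noteq> s \<and> r \<in> {s, q}"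
proof -
  have *: "\<exists>p\<in>F. p \<noteq> s" if "2 \<le> card F" for F
  proof (rule ccontr)
    assume "\<not> ?thesis"
    then have "F \<subseteq> {s}" by blast
    then have "card F \<le> card {s}" by (intro card_mono) auto
    then show False using that by simp
  qed
  show ?thesis
  proof (cases "r = s")
    case True then show ?thesis using *[OF assms(1)] *[OF assms(2)] by blast
  next
    case False then show ?thesis using *[OF assms(1)] assms(3) by blast
  qed
qed

text \<open>At most three colours are committed at each end of the central edge, with
  \<open>ru\<close> and \<open>rv\<close> among them. These coincide or are not both in
  \<open>K\<close>, so at most five colours of \<open>K\<close> are committed. Completing the pairs
  by \<open>extend_to_pair\<close> keeps this bound, and two colours of \<open>K\<close> remain for
  the central edge.\<close>

lemma choose_on_double_star:
  assumes card: "card X1 = 7" "card X2 = 7" "card Y1 = 7" "card Y2 = 7" "card K = 7"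
    and r: "ru \<notin> K \<or> rv \<notin> K \<or> ru = rv"
    and s: "s \<in> X1" "t \<in> Y1"
    and F: "Fa \<subseteq> X2" "Fb \<subseteq> X2" "2 \<le> card Fa" "2 \<le> card Fb" "ru \<in> Fb"
    and H: "Ha \<subseteq> Y2" "Hb \<subseteq> Y2" "2 \<le> card Ha" "2 \<le> card Hb" "rv \<in> Hb"
  shows "\<exists>f1 f2 g1 g2 k. f1 \<subseteq> X1 \<and> f2 \<subseteq> X2 \<and> g1 \<subseteq> Y1 \<and> g2 \<subseteq> Y2 \<and> k \<subseteq> K \<and>
    card f1 = 2 \<and> card f2 = 2 \<and> card g1 = 2 \<and> card g2 = 2 \<and> card k = 2 \<and>
    f1 \<inter> f2 = {} \<and> g1 \<inter> g2 = {} \<and> k \<inter> (f1 \<union> f2 \<union> g1 \<union> g2) = {} \<and>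
    s \<in> f1 \<and> t \<in> g1 \<and> f2 \<inter> Fa \<noteq> {} \<and> f2 \<inter> Fb \<noteq> {} \<and> g2 \<inter> Ha \<noteq> {} \<and> g2 \<inter> Hb \<noteq> {}"
proof -
  obtain p q where pq: "p \<in> Fa" "q \<in> Fb" "p \<noteq> s" "q \<noteq> s" "ru \<in> {s, q}"
    using pick_distinct_from[OF F(3-5)] by blast
  obtain p' q' where pq': "p' \<in> Ha" "q' \<in> Hb" "p' \<noteq> t" "q' \<noteq> t" "rv \<in> {t, q'}"
    using pick_distinct_from[OF H(3-5)] by blast
  define W where "W = {s, p, q, t, p', q'}"
  have fK: "finite K" using card(5) by (metis card.infinite zero_neq_numeral)
  define U V where "U = {s, p, q}" and "V = {t, p', q'}"
  have UV: "W = U \<union> V" "ru \<in> U" "rv \<in> V" using pq(5) pq'(5) by (auto simp: W_def U_def V_def)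
  have fUV: "finite U" "finite V" by (simp_all add: U_def V_def)
  have c3: "card U \<le> 3" "card V \<le> 3" by (simp_all add: U_def V_def card_insert_if)
  then have c2: "card (U - {ru}) \<le> 2" "card (V - {rv}) \<le> 2" using UV(2,3) fUV by simp_all
  have "K \<inter> W \<subseteq> (U - {ru}) \<union> V \<or> K \<inter> W \<subseteq> U \<union> (V - {rv})"
    using r UV by auto
  then have "card (K \<inter> W) \<le> card ((U - {ru}) \<union> V) \<or> card (K \<inter> W) \<le> card (U \<union> (V - {rv}))"
    using fUV by (meson card_mono finite_Diff finite_UnI)
  then have W: "card (K \<inter> W) \<le> 5"
    using card_Un_le[of "U - {ru}" V] card_Un_le[of U "V - {rv}"] c2 c3 by linarith
  have pair: "card {x, y} \<le> 2" for x y :: 'a by (simp add: card_insert_if)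
  \<comment> \<open>In each half the late edge is completed first, avoiding only the colour forced
    on its sibling; the sibling then avoids the finished pair. So never more than two colours are
    forbidden.\<close>
  have "\<exists>f2. {p, q} \<subseteq> f2 \<and> f2 \<subseteq> X2 \<and> card f2 = 2 \<and> f2 \<inter> {s} = {} \<and> card (K \<inter> (W \<union> f2)) \<le> 5"
    by (rule extend_to_pair) (use card pq F W pair in \<open>auto simp: W_def\<close>)
  then obtain f2 where f2: "{p, q} \<subseteq> f2" "f2 \<subseteq> X2" "card f2 = 2" "f2 \<inter> {s} = {}"
    and W2: "card (K \<inter> (W \<union> f2)) \<le> 5" by blast
  have "\<exists>f1. {s} \<subseteq> f1 \<and> f1 \<subseteq> X1 \<and> card f1 = 2 \<and> f1 \<inter> f2 = {} \<and> card (K \<inter> (W \<union> f2 \<union> f1)) \<le> 5"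
    by (rule extend_to_pair)
      (use card f2 s W2 card.infinite in \<open>fastforce simp: W_def\<close>)+
  then obtain f1 where f1: "s \<in> f1" "f1 \<subseteq> X1" "card f1 = 2" "f1 \<inter> f2 = {}"
    and W1: "card (K \<inter> (W \<union> f2 \<union> f1)) \<le> 5" by blast
  have "\<exists>g2. {p', q'} \<subseteq> g2 \<and> g2 \<subseteq> Y2 \<and> card g2 = 2 \<and> g2 \<inter> {t} = {} \<and> card (K \<inter> (W \<union> f2 \<union> f1 \<union> g2)) \<le> 5"
    by (rule extend_to_pair) (use card pq' H W1 pair in \<open>auto simp: W_def\<close>)
  then obtain g2 where g2: "{p', q'} \<subseteq> g2" "g2 \<subseteq> Y2" "card g2 = 2" "g2 \<inter> {t} = {}"
    and W3: "card (K \<inter> (W \<union> f2 \<union> f1 \<union> g2)) \<le> 5" by blast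
  have "\<exists>g1. {t} \<subseteq> g1 \<and> g1 \<subseteq> Y1 \<and> card g1 = 2 \<and> g1 \<inter> g2 = {} \<and> card (K \<inter> (W \<union> f2 \<union> f1 \<union> g2 \<union> g1)) \<le> 5"
    by (rule extend_to_pair)
      (use card g2 s W3 card.infinite in \<open>fastforce simp: W_def\<close>)+
  then obtain g1 where g1: "t \<in> g1" "g1 \<subseteq> Y1" "card g1 = 2" "g1 \<inter> g2 = {}"
    and W4: "card (K \<inter> (W \<union> f2 \<union> f1 \<union> g2 \<union> g1)) \<le> 5" by blast
  have "2 \<le> card (K - (W \<union> f2 \<union> f1 \<union> g2 \<union> g1))"
    using W4 card(5) fK by (simp add: card_Diff_subset_Int)
  then obtain k where k: "k \<subseteq> K - (W \<union> f2 \<union> f1 \<union> g2 \<union> g1)" "card k = 2"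
    by (meson obtain_subset_with_card_n)
  have "f2 \<inter> Fa \<noteq> {}" "f2 \<inter> Fb \<noteq> {}" "g2 \<inter> Ha \<noteq> {}" "g2 \<inter> Hb \<noteq> {}"
    using f2(1) g2(1) pq(1,2) pq'(1,2) by blast+
  moreover have "k \<subseteq> K" "k \<inter> (f1 \<union> f2 \<union> g1 \<union> g2) = {}" using k(1) by blast+
  ultimately show ?thesis using f1 f2(2,3) g1 g2(2,3) k(2)
    by (intro exI[of _ f1] exI[of _ f2] exI[of _ g1] exI[of _ g2] exI[of _ k]) simp
qed

section \<open>Cycles\<close>

text \<open>Cyclic constraints do not depend on where the numbering starts, so a propagation may
  begin at any position \<open>t\<close>.\<close>

lemma rotate_cyclic:
  assumes "t < n" and "\<exists>\<sigma>. \<forall>i<n. Q ((i + t) mod n) (\<sigma> i) (\<sigma> (Suc i mod n))"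
  shows "\<exists>\<sigma>. \<forall>i<n. Q i (\<sigma> i) (\<sigma> (Suc i mod n))"
proof -
  obtain \<sigma> where \<sigma>: "\<And>i. i < n \<Longrightarrow> Q ((i + t) mod n) (\<sigma> i) (\<sigma> (Suc i mod n))"
    using assms(2) by blast
  \<comment> \<open>Adding \<open>n - t\<close> replaces subtracting \<open>t\<close>, which natural
    numbers would truncate.\<close>
  define \<tau> where "\<tau> i = \<sigma> ((i + (n - t)) mod n)" for i
  have "Q i (\<tau> i) (\<tau> (Suc i mod n))" if i: "i < n" for i
  proof -
    define j where "j = (i + (n - t)) mod n"
    have j: "j < n" using i unfolding j_def by simp
    have "(j + t) mod n = (i + (n - t) + t) mod n" unfolding j_def by (simp add: mod_simps)
    also have "i + (n - t) + t = i + n" using assms(1) by simp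
    finally have "(j + t) mod n = i" using i by simp
    moreover have "\<tau> (Suc i mod n) = \<sigma> (Suc j mod n)" unfolding \<tau>_def j_def by (simp add: mod_simps)
    ultimately show ?thesis using \<sigma>[OF j] unfolding \<tau>_def j_def by simp
  qed
  then show ?thesis by blast
qed

text \<open>Colours are chosen from \<open>n\<close> downwards, each compatible with its successor.
  A position in \<open>T\<close> takes its prescribed colour instead and restarts the propagation,
  so its own constraint towards the successor is given up.\<close>

lemma propagate_down:
  assumes "0 < m" "\<And>i. card (L i) = m" "\<And>i. card (A i) = m" "\<And>i. i \<in> T \<Longrightarrow> r i \<in> L i"
  shows "\<exists>\<sigma>. \<sigma> n = c \<and>
    (\<forall>i<n. \<sigma> i \<in> L i \<and> (if i \<in> T then \<sigma> i = r i else compat (A i) (\<sigma> i) (\<sigma> (Suc i))))"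
\<comment> \<open>The topmost position is coloured first; its colour is the new boundary value for
  the positions below it, hence \<open>c\<close> is generalised.\<close>
proof (induction n arbitrary: c)
  case 0
  show ?case by (rule exI[of _ "\<lambda>_. c"]) simp
next
  case (Suc n)
  have "finite (L n)" "finite (A n)" "L n \<noteq> {}"
    using assms(1-3) by (metis card_gt_0_iff)+
  then have "\<exists>d\<in>L n. compat (A n) d c" using assms(2,3) by (intro ex_compat) simp_all
  then obtain d where d: "d \<in> L n" "if n \<in> T then d = r n else compat (A n) d c"
    using assms(4) by metis
  obtain \<sigma> where "\<sigma> n = d"
    "\<forall>i<n. \<sigma> i \<in> L i \<and> (if i \<in> T then \<sigma> i = r i else compat (A i) (\<sigma> i) (\<sigma> (Suc i)))"
    using Suc.IH[of d] by blast
  then show ?case using d by (intro exI[of _ "\<sigma>(Suc n := c)"]) (auto simp: less_Suc_eq)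
qed

text \<open>The same propagation in the opposite direction, by symmetry of \<open>compat\<close>. It
  is for a start at the upper end of the closing edge.\<close>

lemma propagate_up:
  assumes "0 < m" "\<And>i. card (L i) = m" "\<And>i. card (A i) = m" "c \<in> L 0"
  shows "\<exists>\<sigma>. \<sigma> 0 = c \<and> (\<forall>i. \<sigma> i \<in> L i \<and> compat (A i) (\<sigma> i) (\<sigma> (Suc i)))"
proof -
  have "\<exists>\<sigma>. \<forall>i. (\<sigma> i \<in> L i \<and> (i = 0 \<longrightarrow> \<sigma> i = c)) \<and> compat (A i) (\<sigma> i) (\<sigma> (Suc i))"
  proof (rule dependent_nat_choice)
    show "\<exists>x. x \<in> L 0 \<and> (0 = (0::nat) \<longrightarrow> x = c)" using assms(4) by blast
  next
    fix x i
    have "finite (L (Suc i))" "finite (A i)" "L (Suc i) \<noteq> {}"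
      using assms(1-3) by (metis card_gt_0_iff)+
    then have "\<exists>d\<in>L (Suc i). compat (A i) d x" using assms(2,3) by (intro ex_compat) simp_all
    then show "\<exists>y. (y \<in> L (Suc i) \<and> (Suc i = 0 \<longrightarrow> y = c)) \<and> compat (A i) x y"
      using compat_sym by fastforce
  qed
  then show ?thesis by blast
qed

text \<open>The difficulty is closing the cycle. A late position closes it by giving up its own
  constraint. Without late positions, a colour outside \<open>A i\<close> at either end of edge
  \<open>i\<close> satisfies that edge whatever the other end gets, and the propagation runs along
  all other edges. If no such colour exists, all lists coincide and one colour serves
  everywhere.\<close>

lemma cyclic_slots:
  assumes n: "0 < n" and m: "0 < m" and L: "\<And>i. i < n \<Longrightarrow> card (L i) = m"
    and A: "\<And>i. i < n \<Longrightarrow> card (A i) = m" and r: "\<And>i. i < n \<Longrightarrow> i \<in> T \<Longrightarrow> r i \<in> L i"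
  shows "\<exists>\<sigma>. \<forall>i<n. \<sigma> i \<in> L i \<and>
    (if i \<in> T then \<sigma> i = r i else compat (A i) (\<sigma> i) (\<sigma> (Suc i mod n)))"
    (is "\<exists>\<sigma>. \<forall>i<n. ?Q i (\<sigma> i) (\<sigma> (Suc i mod n))")
proof -
  have fin: "finite (L i)" "finite (A i)" "L i \<noteq> {}" if "i < n" for i
    using L[OF that] A[OF that] m by (metis card_gt_0_iff)+
  have suc: "Suc i mod n = (if Suc i = n then 0 else Suc i)" if "i < n" for i
    using that by simp
  consider (late) t where "t < n" "t \<in> T"
    | (down) i where "i < n" "L i \<noteq> A i" "\<forall>i<n. i \<notin> T"
    | (up) i where "i < n" "L (Suc i mod n) \<noteq> A i" "\<forall>i<n. i \<notin> T"
    | (const) "\<forall>i<n. i \<notin> T" "\<forall>i<n. L i = A i \<and> L (Suc i mod n) = A i"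
    by blast
  then show ?thesis
  proof cases
    case late
    let ?s = "\<lambda>i. (i + t) mod n"
    have s: "?s i < n" for i using n by simp
    have "\<exists>\<sigma>. \<sigma> n = r t \<and> (\<forall>i<n. \<sigma> i \<in> L (?s i) \<and>
        (if i \<in> {i. ?s i \<in> T} then \<sigma> i = r (?s i) else compat (A (?s i)) (\<sigma> i) (\<sigma> (Suc i))))"
      by (rule propagate_down[OF m]) (use L A r s in auto)
    then obtain \<sigma> where \<sigma>: "\<sigma> n = r t" "\<And>i. i < n \<Longrightarrow> \<sigma> i \<in> L (?s i) \<and>
        (if ?s i \<in> T then \<sigma> i = r (?s i) else compat (A (?s i)) (\<sigma> i) (\<sigma> (Suc i)))"
      by auto
    \<comment> \<open>Shifted position 0 is the late position \<open>t\<close> itself, so it carries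
      the same colour \<open>r t\<close> as the artificial position \<open>n\<close>.\<close>
    have "\<sigma> 0 = \<sigma> n" using \<sigma>(1) \<sigma>(2)[OF n] late by simp
    then have "\<sigma> (Suc i mod n) = \<sigma> (Suc i)" if "i < n" for i using suc[OF that] by simp
    then have "\<exists>\<sigma>. \<forall>i<n. ?Q (?s i) (\<sigma> i) (\<sigma> (Suc i mod n))"
      using \<sigma>(2) by (intro exI[of _ \<sigma>]) simp
    then show ?thesis by (rule rotate_cyclic[OF late(1)])
  next
    case down
    \<comment> \<open>The numbering starts just after \<open>i\<close>, so \<open>i\<close> becomes
      position \<open>n - 1\<close> and edge \<open>i\<close> the closing edge. The free colour sits
      at its lower end.\<close>
    define t where "t = Suc i mod n"
    have t: "t < n" using n by (simp add: t_def)
    let ?s = "\<lambda>i. (i + t) mod n"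
    have s: "?s i < n" for i using n by simp
    have last: "?s (n - 1) = i"
    proof -
      have "?s (n - 1) = (n - 1 + Suc i) mod n" unfolding t_def by (simp add: mod_simps)
      also have "n - 1 + Suc i = i + n" using n by simp
      finally show ?thesis using down(1) by simp
    qed
    obtain d where d: "d \<in> L i" "d \<notin> A i"
      using ex_mem_diff_of_card_eq[of "A i" "L i"] fin down L A by metis
    \<comment> \<open>The set of late positions is empty, so the value \<open>undefined\<close> is
      never taken.\<close>
    have "\<exists>\<sigma>. \<sigma> (n - 1) = d \<and> (\<forall>i<n - 1. \<sigma> i \<in> L (?s i) \<and>
        (if i \<in> {} then \<sigma> i = undefined else compat (A (?s i)) (\<sigma> i) (\<sigma> (Suc i))))"
      by (rule propagate_down[OF m]) (use L A s in auto)
    then obtain \<sigma> where \<sigma>: "\<sigma> (n - 1) = d" "\<And>i. i < n - 1 \<Longrightarrow> \<sigma> i \<in> L (?s i) \<and>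
        compat (A (?s i)) (\<sigma> i) (\<sigma> (Suc i))"
      by auto
    have "?Q (?s j) (\<sigma> j) (\<sigma> (Suc j mod n))" if j: "j < n" for j
    proof (cases "j = n - 1")
      case True
      then show ?thesis using d last \<sigma>(1) down(1,3) by (simp add: compat_def)
    next
      case False
      then show ?thesis using \<sigma>(2)[of j] j down(3) s by simp
    qed
    then have "\<exists>\<sigma>. \<forall>i<n. ?Q (?s i) (\<sigma> i) (\<sigma> (Suc i mod n))" by blast
    then show ?thesis by (rule rotate_cyclic[OF t])
  next
    case up
    \<comment> \<open>Edge \<open>i\<close> is again the closing edge, but the free colour now sits
      at its upper end, which is shifted position 0.\<close>
    define t where "t = Suc i mod n"
    have t: "t < n" using n by (simp add: t_def)
    let ?s = "\<lambda>i. (i + t) mod n"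
    have s: "?s i < n" for i using n by simp
    have last: "?s (n - 1) = i"
    proof -
      have "?s (n - 1) = (n - 1 + Suc i) mod n" unfolding t_def by (simp add: mod_simps)
      also have "n - 1 + Suc i = i + n" using n by simp
      finally show ?thesis using up(1) by simp
    qed
    obtain d where d: "d \<in> L t" "d \<notin> A i"
      using ex_mem_diff_of_card_eq[of "A i" "L t"] fin up L A t unfolding t_def by metis
    have "\<exists>\<sigma>. \<sigma> 0 = d \<and> (\<forall>i. \<sigma> i \<in> L (?s i) \<and> compat (A (?s i)) (\<sigma> i) (\<sigma> (Suc i)))"
      by (rule propagate_up[OF m]) (use L A s d t in auto)
    then obtain \<sigma> where \<sigma>: "\<sigma> 0 = d" "\<And>i. \<sigma> i \<in> L (?s i) \<and>
        compat (A (?s i)) (\<sigma> i) (\<sigma> (Suc i))"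
      by auto
    have "?Q (?s j) (\<sigma> j) (\<sigma> (Suc j mod n))" if j: "j < n" for j
    proof (cases "j = n - 1")
      case True
      then have "Suc j mod n = 0" using n by simp
      then show ?thesis using True d last \<sigma>(1) \<sigma>(2)[of j] up(1,3) by (simp add: compat_def)
    next
      case False
      then show ?thesis using \<sigma>(2)[of j] j up(3) s by simp
    qed
    then have "\<exists>\<sigma>. \<forall>i<n. ?Q (?s i) (\<sigma> i) (\<sigma> (Suc i mod n))" by blast
    then show ?thesis by (rule rotate_cyclic[OF t])
  next
    case const
    obtain c where c: "c \<in> L 0" using fin(3)[OF n] by blast
    \<comment> \<open>Consecutive vertex lists both equal the list of the edge between them.\<close>
    have "c \<in> L i" if "i < n" for i
      using that
    proof (induction i)
      case (Suc i)
      then show ?case using const(2) by (metis Suc_lessD mod_less)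
    qed (use c in simp)
    then show ?thesis using const(1) by (intro exI[of _ "\<lambda>_. c"]) (simp add: compat_def)
  qed
qed

section \<open>Kernels and Galvin's method\<close>

text \<open>If \<open>S\<close> is the whole cycle, the even positions form a kernel, as the length
  is even. Otherwise \<open>S\<close> splits into arcs, and in each arc every second position is
  taken, counting backwards from its last one: those at odd distance from the next position outside
  \<open>S\<close>.\<close>

lemma kernel_of_even_cycle:
  assumes "even n" "S \<subseteq> {..<n}"
  shows "\<exists>K\<subseteq>S. (\<forall>i\<in>K. Suc i mod n \<notin> K) \<and> (\<forall>i\<in>S - K. Suc i mod n \<in> K)"
proof (cases "S = {..<n}")
  case True
  have suc: "even (Suc i mod n) \<longleftrightarrow> odd i" if "i < n" for i
    using assms(1) that by (metis Suc_lessI even_Suc mod_less mod_self even_zero)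
  then show ?thesis using True by (intro exI[of _ "{i. i < n \<and> even i}"]) auto
next
  case False
  then obtain j where j: "j < n" "j \<notin> S" using assms(2) by blast
  define m where "m i = (LEAST m. (i + m) mod n \<notin> S)" for i
  \<comment> \<open>From \<open>i\<close>, going \<open>n - i\<close> steps to position 0 and
    \<open>j\<close> more steps reaches \<open>j\<close>, so the least number exists.\<close>
  have ex: "(i + (n - i + j)) mod n \<notin> S" if "i < n" for i
    using that j by simp
  have m: "m i = Suc (m (Suc i mod n))" if "i \<in> S" for i
  proof -
    have i: "i < n" using that assms(2) by blast
    have "m i = Suc (LEAST m. (i + Suc m) mod n \<notin> S)"
      unfolding m_def by (rule Least_Suc[where P = "\<lambda>m. (i + m) mod n \<notin> S", OF ex[OF i]]) (use that i in simp)
    then show ?thesis unfolding m_def by (simp add: mod_simps)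
  qed
  have m0: "m i = 0" if "i < n" "i \<notin> S" for i
    using that unfolding m_def by (intro Least_eq_0) simp
  show ?thesis
  proof (intro exI[of _ "{i \<in> S. odd (m i)}"] conjI ballI)
    fix i assume "i \<in> {i \<in> S. odd (m i)}"
    then show "Suc i mod n \<notin> {i \<in> S. odd (m i)}" using m by fastforce
  next
    fix i assume i: "i \<in> S - {i \<in> S. odd (m i)}"
    then have "odd (m (Suc i mod n))" using m by fastforce
    moreover have "Suc i mod n < n" using j(1) by (simp add: mod_less_divisor)
    ultimately show "Suc i mod n \<in> {i \<in> S. odd (m i)}" using m0 by fastforce
  qed blast
qed

text \<open>Galvin's method: a colour is given to a kernel of the positions that list it, so a position
  loses it only if its successor gets it.\<close>

lemma even_cyclic_choice:
  fixes d :: "nat \<Rightarrow> nat"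
  assumes "even n"
    and "\<And>i. i < n \<Longrightarrow> 0 < d i \<Longrightarrow> finite (B i) \<and> d i + d (Suc i mod n) \<le> card (B i)"
  shows "\<exists>f. \<forall>i<n. f i \<subseteq> B i \<and> finite (f i) \<and> card (f i) = d i \<and> f i \<inter> f (Suc i mod n) = {}"
  using assms(2)
\<comment> \<open>The total demand is the measure: giving \<open>x\<close> to a nonempty kernel
  lowers it.\<close>
proof (induction "\<Sum>i<n. d i" arbitrary: d B rule: less_induct)
  case less
  show ?case
  proof (cases "\<forall>i<n. d i = 0")
    case True
    then show ?thesis by (intro exI[of _ "\<lambda>_. {}"]) simp
  next
    case False
    then obtain i0 where i0: "i0 < n" "0 < d i0" by blast
    then have "0 < card (B i0)" using less.prems[OF i0] by linarith
    then obtain x where x: "x \<in> B i0" by fastforce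
    define S where "S = {i. i < n \<and> 0 < d i \<and> x \<in> B i}"
    obtain K where K: "K \<subseteq> S" "\<And>i. i \<in> K \<Longrightarrow> Suc i mod n \<notin> K"
      "\<And>i. i \<in> S \<Longrightarrow> i \<notin> K \<Longrightarrow> Suc i mod n \<in> K"
    proof -
      have "S \<subseteq> {..<n}" unfolding S_def by auto
      from kernel_of_even_cycle[OF assms(1) this] that show thesis by blast
    qed
    define d' where "d' i = (if i \<in> K then d i - 1 else d i)" for i
    define B' where "B' i = B i - {x}" for i
    have "i0 \<in> S" using i0 x unfolding S_def by simp
    then obtain k where k: "k \<in> K" using K(3) by blast
    have KS: "i < n" "0 < d i" "x \<in> B i" if "i \<in> K" for i using that K(1) unfolding S_def by auto
    have "(\<Sum>i<n. d' i) < (\<Sum>i<n. d i)"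
      by (rule sum_strict_mono_ex1) (use k KS[OF k] in \<open>auto simp: d'_def intro!: bexI[of _ k]\<close>)
    moreover have "finite (B' i) \<and> d' i + d' (Suc i mod n) \<le> card (B' i)" if i: "i < n" "0 < d' i" for i
    proof -
      have di: "0 < d i" using i(2) unfolding d'_def by (auto split: if_splits)
      note p = less.prems[OF i(1) di]
      show ?thesis
      proof (cases "x \<in> B i")
        case True
        then have "i \<in> S" using i di unfolding S_def by simp
        \<comment> \<open>A position that lists \<open>x\<close> is in the kernel or has its
          successor there, so one of the two demands drops and pays for the loss of
          \<open>x\<close>.\<close>
        then have "d' i + d' (Suc i mod n) < d i + d (Suc i mod n)"
          using K(2,3) KS(2) di unfolding d'_def by (cases "i \<in> K") auto
        then show ?thesis using p True unfolding B'_def by auto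
      next
        case False
        have "d' i + d' (Suc i mod n) \<le> d i + d (Suc i mod n)" unfolding d'_def by auto
        then show ?thesis using p False unfolding B'_def by auto
      qed
    qed
    ultimately have "\<exists>f. \<forall>i<n. f i \<subseteq> B' i \<and> finite (f i) \<and> card (f i) = d' i \<and> f i \<inter> f (Suc i mod n) = {}"
      by (rule less.hyps)
    then obtain f where f: "\<And>i. i < n \<Longrightarrow> f i \<subseteq> B' i \<and> finite (f i) \<and> card (f i) = d' i \<and> f i \<inter> f (Suc i mod n) = {}"
      by blast
    have xf: "x \<notin> f i" if "i < n" for i using f[OF that] unfolding B'_def by blast
    define g where "g i = (if i \<in> K then insert x (f i) else f i)" for i
    have "g i \<subseteq> B i \<and> finite (g i) \<and> card (g i) = d i \<and> g i \<inter> g (Suc i mod n) = {}" if i: "i < n" for i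
    proof -
      have s: "Suc i mod n < n" using i by simp
      have "card (g i) = d i" using f[OF i] xf[OF i] KS(2)[of i] unfolding g_def d'_def by auto
      moreover have "g i \<inter> g (Suc i mod n) = {}"
        using f[OF i] xf[OF i] xf[OF s] K(2) unfolding g_def by auto
      moreover have "g i \<subseteq> B i" using f[OF i] KS(3)[of i] unfolding g_def B'_def by auto
      ultimately show ?thesis using f[OF i] unfolding g_def by auto
    qed
    then show ?thesis by blast
  qed
qed

section \<open>From positions to vertices and edges of a cycle\<close>

lemma Suc_mod_inj:
  assumes "Suc i mod n = Suc j mod n" "i < n" "j < n"
  shows "i = j"
  using assms by (metis Suc_inject Suc_lessI mod_less mod_self nat.distinct(1))

text \<open>A late vertex gives up the constraint towards its successor only. Its predecessor is not
  late, because no two late vertices are adjacent on the cycle, so the edge to the predecessor is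
  the one that stays compatible.\<close>

lemma cycle_slots:
  assumes K: "is_cycle K" and m: "0 < m" and L: "\<And>v. v \<in> verts K \<Longrightarrow> card (L v) = m"
    and A: "\<And>e. e \<in> edges K \<Longrightarrow> card (A e) = m"
    and r: "\<And>v. v \<in> verts K \<Longrightarrow> v \<in> T \<Longrightarrow> r v \<in> L v"
    and T: "\<And>v w. {v, w} \<in> edges K \<Longrightarrow> v \<in> T \<Longrightarrow> w \<notin> T"
  shows "\<exists>\<sigma>. (\<forall>v\<in>verts K. \<sigma> v \<in> L v) \<and>
    (\<forall>v w. {v, w} \<in> edges K \<longrightarrow> v \<notin> T \<longrightarrow> w \<notin> T \<longrightarrow> compat (A {v, w}) (\<sigma> v) (\<sigma> w)) \<and>
    (\<forall>v\<in>verts K. v \<in> T \<longrightarrow> \<sigma> v = r v \<and> (\<exists>w. {v, w} \<in> edges K \<and> compat (A {v, w}) (\<sigma> v) (\<sigma> w)))"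
proof -
  obtain vs where vs: "3 \<le> length vs" "distinct vs" "verts K = set vs"
    "edges K = {{vs ! i, vs ! (Suc i mod length vs)} | i. i < length vs}"
    using K unfolding is_cycle_def by blast
  define n where "n = length vs"
  define e where "e i = {vs ! i, vs ! (Suc i mod n)}" for i
  have n: "0 < n" using vs(1) unfolding n_def by linarith
  have eK: "e i \<in> edges K" if "i < n" for i using that unfolding vs(4) n_def e_def by blast
  have vK: "vs ! i \<in> verts K" if "i < n" for i using that unfolding vs(3) n_def by simp
  define idx where "idx v = (SOME i. i < n \<and> vs ! i = v)" for v
  have idx: "idx (vs ! i) = i" if "i < n" for i
    unfolding idx_def using that vs(2) unfolding n_def
    by (intro some_equality) (auto simp: nth_eq_iff_index_eq)
  have "\<exists>\<sigma>. \<forall>i<n. \<sigma> i \<in> L (vs ! i) \<and> (if i \<in> {i. vs ! i \<in> T} then \<sigma> i = r (vs ! i)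
      else compat (A (e i)) (\<sigma> i) (\<sigma> (Suc i mod n)))"
    by (rule cyclic_slots[OF n m]) (use L A r eK vK in auto)
  then obtain \<tau> where \<tau>: "\<And>i. i < n \<Longrightarrow> \<tau> i \<in> L (vs ! i)"
    "\<And>i. i < n \<Longrightarrow> vs ! i \<in> T \<Longrightarrow> \<tau> i = r (vs ! i)"
    "\<And>i. i < n \<Longrightarrow> vs ! i \<notin> T \<Longrightarrow> compat (A (e i)) (\<tau> i) (\<tau> (Suc i mod n))"
    by (metis mem_Collect_eq)
  define \<sigma> where "\<sigma> v = \<tau> (idx v)" for v
  have ex: "\<exists>i<n. v = vs ! i" if "v \<in> verts K" for v
    using that unfolding vs(3) n_def by (metis in_set_conv_nth)
  have s: "Suc i mod n < n" for i using n by simp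
  show ?thesis
  proof (intro exI[of _ \<sigma>] conjI allI ballI impI)
    fix v assume "v \<in> verts K"
    then show "\<sigma> v \<in> L v" using ex \<tau>(1) idx unfolding \<sigma>_def by force
  next
    fix v w assume vw: "{v, w} \<in> edges K" "v \<notin> T" "w \<notin> T"
    then obtain i where i: "i < n" "{v, w} = e i" unfolding vs(4) e_def n_def by blast
    then have *: "v = vs ! i \<and> w = vs ! (Suc i mod n) \<or> w = vs ! i \<and> v = vs ! (Suc i mod n)"
      unfolding e_def by (auto simp: doubleton_eq_iff)
    then have "vs ! i \<notin> T" using vw by auto
    then have "compat (A {v, w}) (\<tau> i) (\<tau> (Suc i mod n))" using \<tau>(3) i by simp
    then show "compat (A {v, w}) (\<sigma> v) (\<sigma> w)"
      using * idx[OF i(1)] idx[OF s, of i] compat_sym unfolding \<sigma>_def by metis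
  next
    fix v assume v: "v \<in> verts K" "v \<in> T"
    then obtain i where i: "i < n" "v = vs ! i" using ex by blast
    show "\<sigma> v = r v" using \<tau>(2) v i idx unfolding \<sigma>_def by simp
    \<comment> \<open>The cyclic predecessor of \<open>i\<close>; adding \<open>n - 1\<close> avoids
      truncated subtraction at 0.\<close>
    define j where "j = (i + (n - 1)) mod n"
    have j: "j < n" using n by (simp add: j_def)
    have "Suc j mod n = (i + n) mod n" unfolding j_def using n by (simp add: mod_simps)
    then have ji: "Suc j mod n = i" using i by simp
    have ej: "e j = {v, vs ! j}" unfolding e_def ji i(2) by blast
    then have "vs ! j \<notin> T" using T v(2) eK[OF j] by metis
    then have "compat (A (e j)) (\<tau> j) (\<tau> i)" using \<tau>(3)[OF j] ji by simp
    then have "compat (A {v, vs ! j}) (\<sigma> v) (\<sigma> (vs ! j))"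
      unfolding ej \<sigma>_def using idx i j compat_sym by metis
    then show "\<exists>w. {v, w} \<in> edges K \<and> compat (A {v, w}) (\<sigma> v) (\<sigma> w)"
      using eK[OF j] ej by metis
  qed
qed

text \<open>The edges of the cycle are themselves arranged cyclically, two of them meeting only if
  consecutive, so the positional choice with constant demand \<open>k\<close> applies.\<close>

lemma even_cycle_choice:
  assumes K: "even_cycle K" and B: "\<And>e. e \<in> edges K \<Longrightarrow> finite (B e) \<and> 2 * k \<le> card (B e)"
  shows "\<exists>f. (\<forall>e\<in>edges K. f e \<subseteq> B e \<and> card (f e) = k) \<and>
    (\<forall>e\<in>edges K. \<forall>e'\<in>edges K. e \<noteq> e' \<longrightarrow> e \<inter> e' \<noteq> {} \<longrightarrow> f e \<inter> f e' = {})"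
proof -
  obtain vs where vs: "3 \<le> length vs" "distinct vs" "verts K = set vs"
    "edges K = {{vs ! i, vs ! (Suc i mod length vs)} | i. i < length vs}" and ev: "even (card (edges K))"
    using K unfolding even_cycle_def is_cycle_def by blast
  define n where "n = length vs"
  define e where "e i = {vs ! i, vs ! (Suc i mod n)}" for i
  have n: "3 \<le> n" using vs(1) unfolding n_def .
  have E: "edges K = e ` {..<n}" unfolding vs(4) e_def n_def by blast
  have nth: "vs ! i = vs ! j \<longleftrightarrow> i = j" if "i < n" "j < n" for i j
    using that vs(2) unfolding n_def by (simp add: nth_eq_iff_index_eq)
  have s: "Suc i mod n < n" for i using n by simp
  have adj: "Suc i mod n = j \<or> Suc j mod n = i" if "i < n" "j < n" "i \<noteq> j" "e i \<inter> e j \<noteq> {}" for i j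
  proof -
    have "vs ! i = vs ! j \<or> vs ! i = vs ! (Suc j mod n) \<or> vs ! (Suc i mod n) = vs ! j \<or>
        vs ! (Suc i mod n) = vs ! (Suc j mod n)"
      using that(4) unfolding e_def by fastforce
    then have "i = j \<or> i = Suc j mod n \<or> Suc i mod n = j \<or> Suc i mod n = Suc j mod n"
      using nth[OF that(1,2)] nth[OF that(1) s[of j]] nth[OF s[of i] that(2)] nth[OF s[of i] s[of j]] by blast
    then show ?thesis using that(3) Suc_mod_inj[OF _ that(1,2)] by blast
  qed
  have "inj_on e {..<n}"
  proof (rule inj_onI, rule ccontr)
    fix i j assume ij: "i \<in> {..<n}" "j \<in> {..<n}" "e i = e j" "i \<noteq> j"
    then have i: "i < n" and j: "j < n" by auto
    have "vs ! i = vs ! (Suc j mod n) \<and> vs ! j = vs ! (Suc i mod n)"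
      using ij(3,4) nth[OF i j] unfolding e_def doubleton_eq_iff by metis
    then have "i = Suc j mod n" "j = Suc i mod n" using nth[OF i s] nth[OF j s] by blast+
    \<comment> \<open>Equal edges at different positions would make each position the successor of
      the other, which forces a length below three.\<close>
    then have "Suc j = n \<and> i = 0 \<or> i = Suc j" "Suc i = n \<and> j = 0 \<or> j = Suc i"
      using i j by (metis Suc_lessI mod_less mod_self)+
    then show False using n by auto
  qed
  then have "card (edges K) = n" and inv: "\<And>i. i < n \<Longrightarrow> inv_into {..<n} e (e i) = i"
    unfolding E by (simp_all add: card_image)
  then have "even n" using ev by simp
  then have "\<exists>g. \<forall>i<n. g i \<subseteq> B (e i) \<and> finite (g i) \<and> card (g i) = k \<and> g i \<inter> g (Suc i mod n) = {}"
    by (rule even_cyclic_choice) (use B E in \<open>auto simp flip: mult_2\<close>)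
  then obtain g where g: "\<And>i. i < n \<Longrightarrow> g i \<subseteq> B (e i) \<and> card (g i) = k \<and> g i \<inter> g (Suc i mod n) = {}"
    by blast
  define f where "f x = g (inv_into {..<n} e x)" for x
  have f: "f (e i) = g i" if "i < n" for i unfolding f_def inv[OF that] ..
  show ?thesis
  proof (intro exI[of _ f] conjI ballI impI)
    fix a assume "a \<in> edges K"
    then obtain i where "i < n" "a = e i" unfolding E by auto
    then show "f a \<subseteq> B a" "card (f a) = k" using f g[of i] by simp_all
  next
    fix a b assume "a \<in> edges K" "b \<in> edges K" and ab: "a \<noteq> b" "a \<inter> b \<noteq> {}"
    then obtain i j where ij: "i < n" "j < n" "a = e i" "b = e j" unfolding E by auto
    then have "Suc i mod n = j \<or> Suc j mod n = i" using adj ab by blast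
    then show "f a \<inter> f b = {}" using g[OF ij(1)] g[OF ij(2)] f ij by auto
  qed
qed

section \<open>Components and double-stars\<close>

text \<open>Indexing components by a representative vertex allows choices made per component to be
  looked up from a vertex or from an end of an edge.\<close>

definition component :: "'a graph \<Rightarrow> 'a \<Rightarrow> 'a graph" where
  "component H u = induced_subgraph H {v \<in> verts H. reachable H u v}"

lemma graph_components_eq: "graph_components H = component H ` verts H"
  unfolding graph_components_def component_def ..

lemma component_in: "u \<in> verts H \<Longrightarrow> component H u \<in> graph_components H"
  unfolding graph_components_eq by blast

lemma verts_component: "verts (component H u) = {v \<in> verts H. reachable H u v}"
  unfolding component_def induced_subgraph_def by simp

lemma edges_component: "edges (component H u) = {e \<in> edges H. e \<subseteq> verts (component H u)}"
  unfolding component_def induced_subgraph_def by simp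

lemma mem_verts_component: "u \<in> verts H \<Longrightarrow> u \<in> verts (component H u)"
  unfolding verts_component reachable_def by simp

lemma reachable_sym: "reachable H u v \<Longrightarrow> reachable H v u"
proof -
  have "symp (\<lambda>u v. {u, v} \<in> edges H)" by (simp add: symp_def insert_commute)
  then show "reachable H u v \<Longrightarrow> reachable H v u"
    unfolding reachable_def by (rule sympD[OF symp_rtranclp])
qed

lemma component_eq:
  assumes "reachable H u v"
  shows "component H u = component H v"
proof -
  have "reachable H u w \<longleftrightarrow> reachable H v w" for w
    using assms reachable_sym[OF assms] unfolding reachable_def by (meson rtranclp_trans)
  then show ?thesis unfolding component_def by simp
qed

lemma component_eq_of_mem: "v \<in> verts (component H u) \<Longrightarrow> component H v = component H u"
  using component_eq[of H u v] unfolding verts_component by simp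

lemma simple_graph_edgeE:
  assumes "simple_graph H" "e \<in> edges H" "u \<in> e"
  obtains v where "e = {u, v}" "u \<noteq> v" "u \<in> verts H" "v \<in> verts H"
proof -
  have e: "e \<subseteq> verts H" "card e = 2" using assms unfolding simple_graph_def by blast+
  then obtain a b where "e = {a, b}" "a \<noteq> b" by (meson card_2_iff)
  then show thesis using e(1) assms(3) that[of a] that[of b] by auto
qed

lemma edge_in_component:
  assumes "simple_graph H" "e \<in> edges H" "u \<in> e"
  shows "e \<in> edges (component H u)"
proof -
  obtain v where v: "e = {u, v}" "u \<in> verts H" "v \<in> verts H"
    using simple_graph_edgeE[OF assms] by blast
  then have "reachable H u v" using assms(2) unfolding reachable_def by (intro r_into_rtranclp) simp
  then show ?thesis using v assms(2) mem_verts_component[of u H] unfolding edges_component verts_component by simp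
qed

lemma component_eq_of_edge:
  assumes "simple_graph H" "e \<in> edges H" "u \<in> e" "v \<in> e"
  shows "component H u = component H v"
proof -
  have "v \<in> verts (component H u)"
    using edge_in_component[OF assms(1-3)] assms(4) unfolding edges_component by auto
  then show ?thesis by (rule component_eq_of_mem[symmetric])
qed

text \<open>No edge leaves a component, so degrees found inside a cycle or a double-star are degrees
  in the whole part of the decomposition.\<close>

lemma incident_edges_component:
  assumes "simple_graph H" "v \<in> verts (component H u)"
  shows "{e \<in> edges (component H u). v \<in> e} = {e \<in> edges H. v \<in> e}"
proof -
  have "e \<in> edges (component H u)" if "e \<in> edges H" "v \<in> e" for e
    using edge_in_component[OF assms(1) that] component_eq_of_mem[OF assms(2)] by simp
  then show ?thesis unfolding edges_component by auto
qed

lemma vdegree_component: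
  assumes "simple_graph H" "v \<in> verts (component H u)"
  shows "vdegree (component H u) v = vdegree H v"
  unfolding vdegree_def incident_edges_component[OF assms] ..

lemma vdegree_cycle:
  assumes "is_cycle K" "v \<in> verts K"
  shows "vdegree K v = 2"
proof -
  obtain vs where vs: "3 \<le> length vs" "distinct vs" "verts K = set vs"
    "edges K = {{vs ! i, vs ! (Suc i mod length vs)} | i. i < length vs}"
    using assms(1) unfolding is_cycle_def by blast
  define n where "n = length vs"
  have n: "3 \<le> n" using vs(1) unfolding n_def .
  obtain i where i: "i < n" "v = vs ! i" using assms(2) unfolding vs(3) n_def by (metis in_set_conv_nth)
  have nth: "vs ! i = vs ! j \<longleftrightarrow> i = j" if "i < n" "j < n" for i j
    using that vs(2) unfolding n_def by (simp add: nth_eq_iff_index_eq)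
  have s: "Suc i mod n < n" for i using n by simp
  define j where "j = (i + (n - 1)) mod n"
  have j: "j < n" using n by (simp add: j_def)
  have "Suc j mod n = (i + n) mod n" unfolding j_def using n by (simp add: mod_simps)
  then have ji: "Suc j mod n = i" using i by simp
  have "{e \<in> edges K. v \<in> e} = {{v, vs ! (Suc i mod n)}, {vs ! j, v}}" (is "?l = ?r")
  proof
    show "?r \<subseteq> ?l" using i j ji unfolding vs(4) n_def by auto
    show "?l \<subseteq> ?r"
    proof
      fix e assume "e \<in> ?l"
      then obtain k where k: "k < n" "e = {vs ! k, vs ! (Suc k mod n)}" "v \<in> e"
        unfolding vs(4) n_def by auto
      then have "k = i \<or> Suc k mod n = i" using nth[OF i(1) k(1)] nth[OF i(1) s[of k]] i(2) by auto
      then have "k = i \<or> k = j" using Suc_mod_inj[of k n j] k(1) j ji by auto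
      then show "e \<in> ?r" using k(2) i(2) ji by auto
    qed
  qed
  \<comment> \<open>Length at least three separates the two neighbours; otherwise the two edges at
    \<open>v\<close> would coincide.\<close>
  moreover have "vs ! (Suc i mod n) \<noteq> vs ! j"
  proof
    assume "vs ! (Suc i mod n) = vs ! j"
    then have "j = Suc i mod n" using nth[OF s j] by simp
    then have "Suc j = n \<and> i = 0 \<or> i = Suc j" "Suc i = n \<and> j = 0 \<or> j = Suc i"
      using i j ji by (metis Suc_lessI mod_less mod_self)+
    then show False using n by auto
  qed
  ultimately show ?thesis unfolding vdegree_def by (auto simp: doubleton_eq_iff)
qed

lemma vdegree_eq_card_neighbours:
  assumes "simple_graph D"
  shows "vdegree D u = card {w. {u, w} \<in> edges D}"
proof -
  have "{e \<in> edges D. u \<in> e} = (\<lambda>w. {u, w}) ` {w. {u, w} \<in> edges D}"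
  proof
    show "{e \<in> edges D. u \<in> e} \<subseteq> (\<lambda>w. {u, w}) ` {w. {u, w} \<in> edges D}"
    proof
      fix e assume e: "e \<in> {e \<in> edges D. u \<in> e}"
      then obtain w where "e = {u, w}" using simple_graph_edgeE[OF assms, of e u] by blast
      then show "e \<in> (\<lambda>w. {u, w}) ` {w. {u, w} \<in> edges D}" using e by blast
    qed
  qed auto
  moreover have "inj_on (\<lambda>w. {u, w}) {w. {u, w} \<in> edges D}"
    by (auto simp: inj_on_def doubleton_eq_iff)
  ultimately show ?thesis unfolding vdegree_def by (simp add: card_image)
qed

section \<open>Shape and colouring of a double-star\<close>

text \<open>The listed vertices and edges form a subgraph that is a cycle. This turns acyclicity
  into a test on vertex lists, needed for lengths three and four.\<close>

lemma tree_no_cycle: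
  assumes "is_tree D" "3 \<le> length vs" "distinct vs"
    and "\<And>i. i < length vs \<Longrightarrow> {vs ! i, vs ! (Suc i mod length vs)} \<in> edges D"
  shows False
proof -
  let ?H = "(set vs, {{vs ! i, vs ! (Suc i mod length vs)} | i. i < length vs})"
  have D: "simple_graph D" using assms(1) unfolding is_tree_def by blast
  have "vs ! i \<in> verts D" if "i < length vs" for i
    using assms(4)[OF that] D unfolding simple_graph_def by blast
  then have "set vs \<subseteq> verts D" by (metis in_set_conv_nth subsetI)
  moreover have "Suc i mod length vs < length vs" for i
    using assms(2) by (intro mod_less_divisor) linarith
  then have "simple_graph ?H"
    using assms(4) D unfolding simple_graph_def by auto
  ultimately have "subgraph ?H D" using assms(4) unfolding subgraph_def by auto
  moreover have "is_cycle ?H" using assms(2,3) unfolding is_cycle_def by auto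
  ultimately show False using assms(1) unfolding is_tree_def by blast
qed

lemma tree_no_triangle:
  assumes "is_tree D" "{a, b} \<in> edges D" "{b, c} \<in> edges D" "{c, a} \<in> edges D" "distinct [a, b, c]"
  shows False
proof (rule tree_no_cycle[OF assms(1) _ assms(5)])
  fix i assume "i < length [a, b, c]"
  then consider "i = 0" | "i = 1" | "i = 2" by fastforce
  then show "{[a, b, c] ! i, [a, b, c] ! (Suc i mod length [a, b, c])} \<in> edges D"
    using assms(2-4) by cases simp_all
qed simp

lemma tree_no_square:
  assumes "is_tree D" "{a, b} \<in> edges D" "{b, c} \<in> edges D" "{c, d} \<in> edges D" "{d, a} \<in> edges D"
    "distinct [a, b, c, d]"
  shows False
proof (rule tree_no_cycle[OF assms(1) _ assms(6)])
  fix i assume "i < length [a, b, c, d]"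
  then consider "i = 0" | "i = 1" | "i = 2" | "i = 3" by fastforce
  then show "{[a, b, c, d] ! i, [a, b, c, d] ! (Suc i mod length [a, b, c, d])} \<in> edges D"
    using assms(2-5) by cases simp_all
qed simp

text \<open>The two adjacent vertices of degree three have no common neighbour, since a tree has no
  triangle. Together with their other neighbours they are six distinct vertices, hence all of them.
  A further edge would close a triangle or a square.\<close>

lemma double_star_shape:
  assumes "double_star D"
  obtains u v x1 x2 y1 y2 where "distinct [u, v, x1, x2, y1, y2]" "verts D = {u, v, x1, x2, y1, y2}"
    "edges D = {{u, v}, {u, x1}, {u, x2}, {v, y1}, {v, y2}}"
proof -
  have tree: "is_tree D" and c6: "card (verts D) = 6"
    using assms unfolding double_star_def by simp_all
  then have D: "simple_graph D" unfolding is_tree_def by simp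
  obtain u v where uv: "{u, v} \<in> edges D" "vdegree D u = 3" "vdegree D v = 3"
    using assms unfolding double_star_def by blast
  have ne: "a \<noteq> b" "a \<in> verts D" "b \<in> verts D" if "{a, b} \<in> edges D" for a b
  proof -
    have *: "{a, b} \<subseteq> verts D" "card {a, b} = 2" using that D unfolding simple_graph_def by blast+
    show "a \<noteq> b" using *(2) by auto
    show "a \<in> verts D" "b \<in> verts D" using *(1) by auto
  qed
  have other: "\<exists>x1 x2. {w. {a, w} \<in> edges D} = {b, x1, x2} \<and> distinct [a, b, x1, x2]"
    if ab: "{a, b} \<in> edges D" "vdegree D a = 3" for a b
  proof -
    let ?N = "{w. {a, w} \<in> edges D}"
    have c: "card ?N = 3" using ab(2) vdegree_eq_card_neighbours[OF D] by simp
    then have "card (?N - {b}) = 2" using ab(1) by simp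
    then obtain x1 x2 where x: "?N - {b} = {x1, x2}" "x1 \<noteq> x2" by (meson card_2_iff)
    have "b \<in> ?N" using ab(1) by simp
    then have "?N = {b, x1, x2}" using x(1) by blast
    moreover have "x1 \<in> ?N - {b}" "x2 \<in> ?N - {b}" unfolding x(1) by simp_all
    then have "x1 \<noteq> b" "x2 \<noteq> b" "a \<noteq> x1" "a \<noteq> x2" using ne(1)[of a] by auto
    ultimately show ?thesis using ne(1)[OF ab(1)] x(2) by (intro exI[of _ x1] exI[of _ x2]) simp
  qed
  obtain x1 x2 where x: "{w. {u, w} \<in> edges D} = {v, x1, x2}" "distinct [u, v, x1, x2]"
    using other[OF uv(1,2)] by blast
  obtain y1 y2 where y: "{w. {v, w} \<in> edges D} = {u, y1, y2}" "distinct [v, u, y1, y2]"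
  proof -
    have "{v, u} \<in> edges D" using uv(1) by (simp only: insert_commute)
    from other[OF this uv(3)] that show thesis by blast
  qed
  have ux: "{u, x1} \<in> edges D" "{u, x2} \<in> edges D" and vy: "{v, y1} \<in> edges D" "{v, y2} \<in> edges D"
    using x(1) y(1) by blast+
  have xy: "a \<noteq> b" if "a \<in> {x1, x2}" "b \<in> {y1, y2}" for a b
  proof
    assume "a = b"
    then have "{a, u} \<in> edges D" "{v, a} \<in> edges D" "distinct [u, v, a]"
      using that ux vy x(2) y(2) by (auto simp: insert_commute)
    then show False using tree_no_triangle[OF tree uv(1)] by blast
  qed
  have dist: "distinct [u, v, x1, x2, y1, y2]"
    using x(2) y(2) xy[of x1 y1] xy[of x1 y2] xy[of x2 y1] xy[of x2 y2] by simp
  moreover have V: "verts D = {u, v, x1, x2, y1, y2}"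
  proof (rule card_subset_eq[symmetric])
    show "finite (verts D)" using D unfolding simple_graph_def by blast
    show "{u, v, x1, x2, y1, y2} \<subseteq> verts D"
      using ne[OF uv(1)] ne[OF ux(1)] ne[OF ux(2)] ne[OF vy(1)] ne[OF vy(2)] by simp
    show "card {u, v, x1, x2, y1, y2} = card (verts D)" using dist c6 by simp
  qed
  moreover have "edges D = {{u, v}, {u, x1}, {u, x2}, {v, y1}, {v, y2}}" (is "_ = ?E")
  proof
    show "?E \<subseteq> edges D" using uv(1) ux vy by blast
    show "edges D \<subseteq> ?E"
    proof
      fix e assume e: "e \<in> edges D"
      show "e \<in> ?E"
      proof (cases "u \<in> e \<or> v \<in> e")
        case True
        then show ?thesis
        proof
          assume "u \<in> e"
          then obtain w where w: "e = {u, w}" using simple_graph_edgeE[OF D e] by blast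
          then have "w \<in> {w. {u, w} \<in> edges D}" using e by simp
          then have "w = v \<or> w = x1 \<or> w = x2" unfolding x(1) by simp
          then show ?thesis unfolding w by (elim disjE) (simp_all add: doubleton_eq_iff)
        next
          assume "v \<in> e"
          then obtain w where w: "e = {v, w}" using simple_graph_edgeE[OF D e] by blast
          then have "w \<in> {w. {v, w} \<in> edges D}" using e by simp
          then have "w = u \<or> w = y1 \<or> w = y2" unfolding y(1) by simp
          then show ?thesis unfolding w by (elim disjE) (simp_all add: doubleton_eq_iff)
        qed
      next
        case False
        have "card e = 2" "e \<subseteq> verts D" using e D unfolding simple_graph_def by blast+
        then obtain a b where ab: "e = {a, b}" "a \<noteq> b" "a \<in> verts D" "b \<in> verts D"
          by (auto simp: card_2_iff)
        \<comment> \<open>Two neighbours of the same vertex being adjacent would give a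
          triangle.\<close>
        have no_xx: "{a, b} \<notin> edges D" if "a \<noteq> b" "{w, a} \<in> edges D" "{w, b} \<in> edges D" for w a b
        proof
          assume "{a, b} \<in> edges D"
          moreover have "{b, w} \<in> edges D" using that(3) by (simp only: insert_commute)
          ultimately show False
            using tree_no_triangle[OF tree that(2), of b] that(1) ne(1)[OF that(2)] ne(1)[OF that(3)] by simp
        qed
        \<comment> \<open>An edge between leaves of different halves would close a square through
          the central edge.\<close>
        have no_xy: "{a, b} \<notin> edges D" if "a \<in> {x1, x2}" "b \<in> {y1, y2}" for a b
        proof
          assume "{a, b} \<in> edges D"
          moreover have "{u, a} \<in> edges D" using that(1) ux by auto
          moreover have "{v, b} \<in> edges D" using that(2) vy by auto
          then have "{b, v} \<in> edges D" by (simp only: insert_commute)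
          moreover have "{v, u} \<in> edges D" using uv(1) by (simp only: insert_commute)
          moreover have "distinct [u, a, b, v]" using that dist by auto
          ultimately show False using tree_no_square[OF tree] by blast
        qed
        have "a \<in> {x1, x2, y1, y2}" "b \<in> {x1, x2, y1, y2}" using ab V False by auto
        then have "a \<in> {x1, x2} \<and> b \<in> {x1, x2} \<or> a \<in> {y1, y2} \<and> b \<in> {y1, y2} \<or>
            a \<in> {x1, x2} \<and> b \<in> {y1, y2} \<or> b \<in> {x1, x2} \<and> a \<in> {y1, y2}" by blast
        then have "{a, b} \<notin> edges D"
        proof (elim disjE)
          assume "a \<in> {x1, x2} \<and> b \<in> {x1, x2}"
          then show ?thesis using no_xx[of a b u] ab(2) ux by auto
        next
          assume "a \<in> {y1, y2} \<and> b \<in> {y1, y2}"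
          then show ?thesis using no_xx[of a b v] ab(2) vy by auto
        next
          assume "a \<in> {x1, x2} \<and> b \<in> {y1, y2}"
          then show ?thesis using no_xy[of a b] by simp
        next
          assume "b \<in> {x1, x2} \<and> a \<in> {y1, y2}"
          then show ?thesis using no_xy[of b a] by (simp add: insert_commute)
        qed
        then show ?thesis using e ab(1) by simp
      qed
    qed
  qed
  ultimately show thesis by (rule that)
qed

lemma double_star_vdegree:
  assumes D: "simple_graph D" and d: "distinct [u, v, x1, x2, y1, y2]"
    and E: "edges D = {{u, v}, {u, x1}, {u, x2}, {v, y1}, {v, y2}}"
  shows "vdegree D u = 3" "vdegree D v = 3" "vdegree D x1 = 1" "vdegree D x2 = 1"
    "vdegree D y1 = 1" "vdegree D y2 = 1"
proof -
  have "{w. {u, w} \<in> edges D} = {v, x1, x2}" "{w. {v, w} \<in> edges D} = {u, y1, y2}"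
    "{w. {x1, w} \<in> edges D} = {u}" "{w. {x2, w} \<in> edges D} = {u}"
    "{w. {y1, w} \<in> edges D} = {v}" "{w. {y2, w} \<in> edges D} = {v}"
    unfolding E using d by (auto simp: doubleton_eq_iff)
  then show "vdegree D u = 3" "vdegree D v = 3" "vdegree D x1 = 1" "vdegree D x2 = 1"
    "vdegree D y1 = 1" "vdegree D y2 = 1"
    using d unfolding vdegree_eq_card_neighbours[OF D] by simp_all
qed

lemma vdegree_in_double_star:
  assumes "double_star D" "w \<in> verts D"
  shows "vdegree D w = 1 \<or> vdegree D w = 3"
proof -
  obtain u v x1 x2 y1 y2 where d: "distinct [u, v, x1, x2, y1, y2]" and V: "verts D = {u, v, x1, x2, y1, y2}"
    and E: "edges D = {{u, v}, {u, x1}, {u, x2}, {v, y1}, {v, y2}}"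
    by (rule double_star_shape[OF assms(1)])
  have D: "simple_graph D" using assms unfolding double_star_def is_tree_def by simp
  show ?thesis using assms(2) double_star_vdegree[OF D d E] unfolding V by auto
qed

text \<open>The quantifiers follow the order of colouring: the late leaves \<open>T\<close> and
  their prescribed colours \<open>r\<close> depend on the lists alone. Only later do the colours
  \<open>s\<close> forced on the other leaves and the candidate sets \<open>Fa\<close>,
  \<open>Fb\<close> become known, and then the whole double-star is coloured. The function
  \<open>p\<close> gives the pendant edge at a leaf.\<close>

lemma double_star_choice:
  fixes L :: "'a set \<Rightarrow> 'c set"
  assumes ds: "double_star D" and L: "\<And>e. e \<in> edges D \<Longrightarrow> card (L e) = 7"
    and p: "\<And>x. x \<in> leaves D \<Longrightarrow> p x \<in> edges D \<and> x \<in> p x"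
  shows "\<exists>T r. T \<subseteq> leaves D \<and> (\<forall>x\<in>T. r x \<in> L (p x)) \<and>
    (\<forall>s Fa Fb. (\<forall>x\<in>leaves D - T. s x \<in> L (p x)) \<longrightarrow>
       (\<forall>x\<in>T. Fa x \<subseteq> L (p x) \<and> Fb x \<subseteq> L (p x) \<and> 2 \<le> card (Fa x) \<and> 2 \<le> card (Fb x) \<and> r x \<in> Fb x) \<longrightarrow>
       (\<exists>f. (\<forall>e\<in>edges D. f e \<subseteq> L e \<and> card (f e) = 2) \<and>
          (\<forall>e\<in>edges D. \<forall>e'\<in>edges D. e \<noteq> e' \<longrightarrow> e \<inter> e' \<noteq> {} \<longrightarrow> f e \<inter> f e' = {}) \<and>
          (\<forall>x\<in>leaves D - T. s x \<in> f (p x)) \<and>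
          (\<forall>x\<in>T. f (p x) \<inter> Fa x \<noteq> {} \<and> f (p x) \<inter> Fb x \<noteq> {})))"
proof -
  obtain u v x1 x2 y1 y2 where d: "distinct [u, v, x1, x2, y1, y2]" and V: "verts D = {u, v, x1, x2, y1, y2}"
    and E: "edges D = {{u, v}, {u, x1}, {u, x2}, {v, y1}, {v, y2}}"
    by (rule double_star_shape[OF ds])
  have D: "simple_graph D" using ds unfolding double_star_def is_tree_def by simp
  have lv: "leaves D = {x1, x2, y1, y2}"
    unfolding leaves_def V by (rule set_eqI) (use double_star_vdegree[OF D d E] in \<open>auto\<close>)
  have leaf: "p x \<in> {{u, v}, {u, x1}, {u, x2}, {v, y1}, {v, y2}}" "x \<in> p x" if "x \<in> {x1, x2, y1, y2}" for x
    using p[of x] that unfolding lv E by blast+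
  have q1: "q = {u, x1}" if "q \<in> {{u, v}, {u, x1}, {u, x2}, {v, y1}, {v, y2}}" "x1 \<in> q" for q
    using that d by (elim insertE) auto
  have q2: "q = {u, x2}" if "q \<in> {{u, v}, {u, x1}, {u, x2}, {v, y1}, {v, y2}}" "x2 \<in> q" for q
    using that d by (elim insertE) auto
  have q3: "q = {v, y1}" if "q \<in> {{u, v}, {u, x1}, {u, x2}, {v, y1}, {v, y2}}" "y1 \<in> q" for q
    using that d by (elim insertE) auto
  have q4: "q = {v, y2}" if "q \<in> {{u, v}, {u, x1}, {u, x2}, {v, y1}, {v, y2}}" "y2 \<in> q" for q
    using that d by (elim insertE) auto
  have px: "p x1 = {u, x1}" "p x2 = {u, x2}" "p y1 = {v, y1}" "p y2 = {v, y2}"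
    by (rule q1[OF leaf] q2[OF leaf] q3[OF leaf] q4[OF leaf]; simp)+
  have c: "card (L {u, v}) = 7" "card (L {u, x1}) = 7" "card (L {u, x2}) = 7" "card (L {v, y1}) = 7"
    "card (L {v, y2}) = 7" using L unfolding E by simp_all
  have "\<exists>ru\<in>L {u, x2}. \<exists>rv\<in>L {v, y2}. ru \<notin> L {u, v} \<or> rv \<notin> L {u, v} \<or> ru = rv"
    by (rule ex_outside_or_common[of 7]) (simp_all add: c)
  then obtain ru rv where r: "ru \<in> L {u, x2}" "rv \<in> L {v, y2}" "ru \<notin> L {u, v} \<or> rv \<notin> L {u, v} \<or> ru = rv"
    by blast
  \<comment> \<open>One late leaf in each half.\<close>
  define T where "T = {x2, y2}"
  define r' where "r' x = (if x = x2 then ru else rv)" for x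
  have r': "r' x2 = ru" "r' y2 = rv" using d unfolding r'_def by auto
  have lT: "leaves D - T = {x1, y1}" using d unfolding lv T_def by auto
  show ?thesis
  proof (intro exI[of _ T] exI[of _ r'] conjI allI impI)
    show "T \<subseteq> leaves D" unfolding T_def lv by simp
    show "\<forall>x\<in>T. r' x \<in> L (p x)" unfolding T_def using r r' px by simp
  next
    fix s Fa Fb
    assume s: "\<forall>x\<in>leaves D - T. s x \<in> L (p x)"
      and F: "\<forall>x\<in>T. Fa x \<subseteq> L (p x) \<and> Fb x \<subseteq> L (p x) \<and> 2 \<le> card (Fa x) \<and> 2 \<le> card (Fb x) \<and> r' x \<in> Fb x"
    have s': "s x1 \<in> L {u, x1}" "s y1 \<in> L {v, y1}" using s px unfolding lT by simp_all
    have F1: "Fa x2 \<subseteq> L {u, x2}" "Fb x2 \<subseteq> L {u, x2}" "2 \<le> card (Fa x2)" "2 \<le> card (Fb x2)" "ru \<in> Fb x2"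
      using bspec[OF F, of x2] px r' unfolding T_def by simp_all
    have F2: "Fa y2 \<subseteq> L {v, y2}" "Fb y2 \<subseteq> L {v, y2}" "2 \<le> card (Fa y2)" "2 \<le> card (Fb y2)" "rv \<in> Fb y2"
      using bspec[OF F, of y2] px r' unfolding T_def by simp_all
    obtain f1 f2 g1 g2 k where f: "f1 \<subseteq> L {u, x1}" "f2 \<subseteq> L {u, x2}" "g1 \<subseteq> L {v, y1}" "g2 \<subseteq> L {v, y2}" "k \<subseteq> L {u, v}"
      "card f1 = 2" "card f2 = 2" "card g1 = 2" "card g2 = 2" "card k = 2"
      and dis: "f1 \<inter> f2 = {}" "g1 \<inter> g2 = {}" "k \<inter> (f1 \<union> f2 \<union> g1 \<union> g2) = {}"
      and hit: "s x1 \<in> f1" "s y1 \<in> g1" "f2 \<inter> Fa x2 \<noteq> {}" "f2 \<inter> Fb x2 \<noteq> {}" "g2 \<inter> Fa y2 \<noteq> {}" "g2 \<inter> Fb y2 \<noteq> {}"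
      using choose_on_double_star[OF c(2,3,4,5,1) r(3) s' F1 F2] by (elim exE conjE) (rule that)
    have dis': "f2 \<inter> f1 = {}" "g2 \<inter> g1 = {}" "k \<inter> f1 = {}" "k \<inter> f2 = {}" "k \<inter> g1 = {}" "k \<inter> g2 = {}"
      "f1 \<inter> k = {}" "f2 \<inter> k = {}" "g1 \<inter> k = {}" "g2 \<inter> k = {}"
      using dis by auto
    have dsym: "v \<noteq> u" "x1 \<noteq> u" "x2 \<noteq> u" "y1 \<noteq> u" "y2 \<noteq> u" "x1 \<noteq> v" "x2 \<noteq> v" "y1 \<noteq> v"
      "y2 \<noteq> v" "x2 \<noteq> x1" "y1 \<noteq> x1" "y2 \<noteq> x1" "y1 \<noteq> x2" "y2 \<noteq> x2" "y2 \<noteq> y1"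
      using d by auto
    define f where "f e = (if e = {u, v} then k else if e = {u, x1} then f1 else if e = {u, x2} then f2
      else if e = {v, y1} then g1 else g2)" for e
    have fe: "f {u, v} = k" "f {u, x1} = f1" "f {u, x2} = f2" "f {v, y1} = g1" "f {v, y2} = g2"
      using d dsym unfolding f_def by (simp_all add: doubleton_eq_iff)
    show "\<exists>f. (\<forall>e\<in>edges D. f e \<subseteq> L e \<and> card (f e) = 2) \<and>
          (\<forall>e\<in>edges D. \<forall>e'\<in>edges D. e \<noteq> e' \<longrightarrow> e \<inter> e' \<noteq> {} \<longrightarrow> f e \<inter> f e' = {}) \<and>
          (\<forall>x\<in>leaves D - T. s x \<in> f (p x)) \<and>
          (\<forall>x\<in>T. f (p x) \<inter> Fa x \<noteq> {} \<and> f (p x) \<inter> Fb x \<noteq> {})"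
    proof (intro exI[of _ f] conjI)
      show "\<forall>e\<in>edges D. f e \<subseteq> L e \<and> card (f e) = 2" unfolding E using fe f by simp
      show "\<forall>e\<in>edges D. \<forall>e'\<in>edges D. e \<noteq> e' \<longrightarrow> e \<inter> e' \<noteq> {} \<longrightarrow> f e \<inter> f e' = {}"
        unfolding E using d dsym by (simp add: fe dis dis')
      show "\<forall>x\<in>leaves D - T. s x \<in> f (p x)" unfolding lT using px fe hit by simp
      show "\<forall>x\<in>T. f (p x) \<inter> Fa x \<noteq> {} \<and> f (p x) \<inter> Fb x \<noteq> {}" unfolding T_def using px fe hit by simp
    qed
  qed
qed

section \<open>MED decompositions\<close>

text \<open>Each vertex takes its colour from the assignment on its own component. Both ends of an
  edge lie in the same component, so all constraints are local.\<close>

lemma slots_on_cycles: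
  assumes H: "simple_graph H" and cyc: "\<And>K. K \<in> graph_components H \<Longrightarrow> is_cycle K"
    and m: "0 < m" and L: "\<And>v. v \<in> verts H \<Longrightarrow> card (L v) = m"
    and A: "\<And>e. e \<in> edges H \<Longrightarrow> card (A e) = m"
    and r: "\<And>v. v \<in> verts H \<Longrightarrow> v \<in> T \<Longrightarrow> r v \<in> L v"
    and T: "\<And>v w. {v, w} \<in> edges H \<Longrightarrow> v \<in> T \<Longrightarrow> w \<notin> T"
  obtains \<sigma> where "\<And>v. v \<in> verts H \<Longrightarrow> \<sigma> v \<in> L v"
    "\<And>v w. {v, w} \<in> edges H \<Longrightarrow> v \<notin> T \<Longrightarrow> w \<notin> T \<Longrightarrow> compat (A {v, w}) (\<sigma> v) (\<sigma> w)"
    "\<And>v. v \<in> verts H \<Longrightarrow> v \<in> T \<Longrightarrow> \<sigma> v = r v"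
    "\<And>v. v \<in> verts H \<Longrightarrow> v \<in> T \<Longrightarrow> \<exists>w. {v, w} \<in> edges H \<and> compat (A {v, w}) (\<sigma> v) (\<sigma> w)"
proof -
  let ?P = "\<lambda>K \<sigma>. (\<forall>v\<in>verts K. \<sigma> v \<in> L v) \<and>
    (\<forall>v w. {v, w} \<in> edges K \<longrightarrow> v \<notin> T \<longrightarrow> w \<notin> T \<longrightarrow> compat (A {v, w}) (\<sigma> v) (\<sigma> w)) \<and>
    (\<forall>v\<in>verts K. v \<in> T \<longrightarrow> \<sigma> v = r v \<and> (\<exists>w. {v, w} \<in> edges K \<and> compat (A {v, w}) (\<sigma> v) (\<sigma> w)))"
  have "\<exists>\<sigma>. ?P K \<sigma>" if K: "K \<in> graph_components H" for K
  proof (rule cycle_slots[OF cyc[OF K] m])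
    obtain u where u: "K = component H u" using K unfolding graph_components_eq by blast
    have V: "v \<in> verts H" if "v \<in> verts K" for v using that unfolding u verts_component by simp
    have E: "e \<in> edges H" if "e \<in> edges K" for e using that unfolding u edges_component by simp
    show "card (L v) = m" if "v \<in> verts K" for v using L[OF V[OF that]] .
    show "card (A e) = m" if "e \<in> edges K" for e using A[OF E[OF that]] .
    show "r v \<in> L v" if "v \<in> verts K" "v \<in> T" for v using r[OF V[OF that(1)] that(2)] .
    show "w \<notin> T" if "{v, w} \<in> edges K" "v \<in> T" for v w using T[OF E[OF that(1)] that(2)] .
  qed
  then obtain S where S: "\<And>K. K \<in> graph_components H \<Longrightarrow> ?P K (S K)" by metis
  define \<sigma> where "\<sigma> v = S (component H v) v" for v
  have P: "?P (component H v) (S (component H v))" if "v \<in> verts H" for v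
    using S[OF component_in[OF that]] .
  have ends: "v \<in> verts H" "component H w = component H v" "{v, w} \<in> edges (component H v)"
    if "{v, w} \<in> edges H" for v w
  proof -
    show "v \<in> verts H" using H that unfolding simple_graph_def by blast
    show "component H w = component H v" using component_eq_of_edge[OF H that] by simp
    show "{v, w} \<in> edges (component H v)" using edge_in_component[OF H that] by simp
  qed
  show thesis
  proof (rule that)
    fix v assume v: "v \<in> verts H"
    show "\<sigma> v \<in> L v" using P[OF v] mem_verts_component[OF v] unfolding \<sigma>_def by simp
  next
    fix v w assume vw: "{v, w} \<in> edges H" "v \<notin> T" "w \<notin> T"
    show "compat (A {v, w}) (\<sigma> v) (\<sigma> w)"
      using P[OF ends(1)[OF vw(1)]] ends[OF vw(1)] vw(2,3) unfolding \<sigma>_def by simp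
  next
    fix v assume v: "v \<in> verts H" "v \<in> T"
    show "\<sigma> v = r v" using P[OF v(1)] v(2) mem_verts_component[OF v(1)] unfolding \<sigma>_def by simp
  next
    fix v assume v: "v \<in> verts H" "v \<in> T"
    obtain w where w: "{v, w} \<in> edges (component H v)"
      "compat (A {v, w}) (S (component H v) v) (S (component H v) w)"
      using P[OF v(1)] v(2) mem_verts_component[OF v(1)] by blast
    have vw: "{v, w} \<in> edges H" using w(1) unfolding edges_component by simp
    then show "\<exists>w. {v, w} \<in> edges H \<and> compat (A {v, w}) (\<sigma> v) (\<sigma> w)"
      using w(2) ends(2)[OF vw] unfolding \<sigma>_def by auto
  qed
qed

text \<open>Incident edges lie in the same component, and either end of an edge determines it; hence
  an arbitrary end may be used to look up the choice.\<close>

lemma choice_on_even_cycles: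
  assumes H: "simple_graph H" and cyc: "\<And>K. K \<in> graph_components H \<Longrightarrow> even_cycle K"
    and B: "\<And>e. e \<in> edges H \<Longrightarrow> finite (B e) \<and> 2 * k \<le> card (B e)"
  obtains f where "\<And>e. e \<in> edges H \<Longrightarrow> f e \<subseteq> B e \<and> card (f e) = k"
    "\<And>e e'. e \<in> edges H \<Longrightarrow> e' \<in> edges H \<Longrightarrow> e \<noteq> e' \<Longrightarrow> e \<inter> e' \<noteq> {} \<Longrightarrow> f e \<inter> f e' = {}"
proof -
  let ?P = "\<lambda>K f. (\<forall>e\<in>edges K. f e \<subseteq> B e \<and> card (f e) = k) \<and>
    (\<forall>e\<in>edges K. \<forall>e'\<in>edges K. e \<noteq> e' \<longrightarrow> e \<inter> e' \<noteq> {} \<longrightarrow> f e \<inter> f e' = {})"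
  have "\<exists>f. ?P K f" if K: "K \<in> graph_components H" for K
  proof (rule even_cycle_choice[OF cyc[OF K]])
    obtain u where u: "K = component H u" using K unfolding graph_components_eq by blast
    show "finite (B e) \<and> 2 * k \<le> card (B e)" if "e \<in> edges K" for e
      using B that unfolding u edges_component by simp
  qed
  then obtain S where S: "\<And>K. K \<in> graph_components H \<Longrightarrow> ?P K (S K)" by metis
  define f where "f e = S (component H (SOME v. v \<in> e)) e" for e
  have f: "f e = S (component H v) e" if "e \<in> edges H" "v \<in> e" for e v
    using component_eq_of_edge[OF H that(1) someI[of "\<lambda>v. v \<in> e", OF that(2)] that(2)] unfolding f_def by simp
  have P: "?P (component H v) (S (component H v))" if "e \<in> edges H" "v \<in> e" for e v
  proof -
    have "v \<in> verts H" using that H unfolding simple_graph_def by blast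
    then show ?thesis by (rule S[OF component_in])
  qed
  have ne: "e \<noteq> {}" if "e \<in> edges H" for e
    using H that unfolding simple_graph_def by (metis card.empty zero_neq_numeral)
  show thesis
  proof (rule that)
    fix e assume e: "e \<in> edges H"
    then obtain v where v: "v \<in> e" using ne by blast
    show "f e \<subseteq> B e \<and> card (f e) = k"
      using P[OF e v] edge_in_component[OF H e v] unfolding f[OF e v] by simp
  next
    fix e e' assume e: "e \<in> edges H" "e' \<in> edges H" "e \<noteq> e'" "e \<inter> e' \<noteq> {}"
    then obtain v where v: "v \<in> e" "v \<in> e'" by blast
    show "f e \<inter> f e' = {}"
      using P[OF e(1) v(1)] edge_in_component[OF H e(1) v(1)] edge_in_component[OF H e(2) v(2)] e(3,4)
      unfolding f[OF e(1) v(1)] f[OF e(2) v(2)] by simp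
  qed
qed

text \<open>\<open>ow v\<close> is the edge at the cycle vertex \<open>v\<close> that is not on the cycle.\<close>

lemma MED_structure:
  assumes G: "simple_graph G" and reg: "regular_graph 3 G" and MED: "MED_decomposition G G1 G2 G3"
  obtains ow where
    "\<And>v e. v \<in> verts G2 \<Longrightarrow> e \<in> edges G1 \<union> edges G3 \<and> v \<in> e \<longleftrightarrow> e = ow v"
    "\<And>e. e \<in> edges G1 \<Longrightarrow> e \<subseteq> verts G2"
    "\<And>D x. D \<in> graph_components G3 \<Longrightarrow> x \<in> leaves D \<Longrightarrow> x \<in> verts G2 \<and> ow x \<in> edges D"
    "\<And>v. v \<in> verts G2 \<Longrightarrow> ow v \<in> edges G3 \<Longrightarrow> v \<in> verts G3 \<and> v \<in> leaves (component G3 v)"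
proof -
  let ?I = "\<lambda>H v. {e \<in> edges H. v \<in> e}"
  have sub: "subgraph G1 G" "subgraph G2 G" "subgraph G3 G"
    and E: "edges G1 \<union> edges G2 \<union> edges G3 = edges G"
    and disj: "edges G1 \<inter> edges G2 = {}" "edges G1 \<inter> edges G3 = {}" "edges G2 \<inter> edges G3 = {}"
    and mat: "is_matching G1" and cyc: "\<And>K. K \<in> graph_components G2 \<Longrightarrow> even_cycle K"
    and ids: "independent_double_stars G G3"
    using MED unfolding MED_decomposition_def by blast+
  have simp: "simple_graph G1" "simple_graph G2" "simple_graph G3" using sub unfolding subgraph_def by blast+
  have "finite (edges G)"
    using G unfolding simple_graph_def by (meson PowI finite_Pow_iff finite_subset subsetI)
  then have fin: "finite (?I H v)" if "subgraph H G" for H v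
    using that finite_subset[of "?I H v" "edges G"] unfolding subgraph_def by blast
  have deg: "vdegree G1 v + vdegree G2 v + vdegree G3 v = 3" if "v \<in> verts G" for v
  proof -
    have "?I G v = (?I G1 v \<union> ?I G2 v) \<union> ?I G3 v" using E by blast
    moreover have "card ((?I G1 v \<union> ?I G2 v) \<union> ?I G3 v) = card (?I G1 v \<union> ?I G2 v) + card (?I G3 v)"
      using fin sub disj by (intro card_Un_disjoint) auto
    moreover have "card (?I G1 v \<union> ?I G2 v) = card (?I G1 v) + card (?I G2 v)"
      using fin sub disj by (intro card_Un_disjoint) auto
    moreover have "vdegree G v = 3" using reg that unfolding regular_graph_def by blast
    ultimately show ?thesis unfolding vdegree_def by simp
  qed
  have d1: "vdegree G1 v \<le> 1" for v
  proof -
    have "a = b" if "a \<in> ?I G1 v" "b \<in> ?I G1 v" for a b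
      using that mat unfolding is_matching_def by blast
    then show ?thesis
      using card_le_Suc0_iff_eq[OF fin[OF sub(1)], of v] unfolding vdegree_def One_nat_def by blast
  qed
  have out: "vdegree H v = 0" if "simple_graph H" "v \<notin> verts H" for H :: "'a graph" and v
  proof -
    have "?I H v = {}" using that unfolding simple_graph_def by blast
    then show ?thesis unfolding vdegree_def by (simp only: card.empty)
  qed
  have d2: "vdegree G2 v = 2" if "v \<in> verts G2" for v
    using vdegree_cycle[of "component G2 v" v] cyc[OF component_in[OF that]] mem_verts_component[OF that]
      vdegree_component[OF simp(2) mem_verts_component[OF that]] unfolding even_cycle_def by simp
  have d3: "vdegree G3 v = 1 \<or> vdegree G3 v = 3" if "v \<in> verts G3" for v
    using vdegree_in_double_star[of "component G3 v" v] ids component_in[OF that] mem_verts_component[OF that]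
      vdegree_component[OF simp(3) mem_verts_component[OF that]] unfolding independent_double_stars_def by simp
  \<comment> \<open>The cycle uses two of the three edges at \<open>v\<close>, so exactly one
    remains for the other two parts.\<close>
  have "\<exists>a. \<forall>e. e \<in> edges G1 \<union> edges G3 \<and> v \<in> e \<longleftrightarrow> e = a" if v: "v \<in> verts G2" for v
  proof -
    have vG: "v \<in> verts G" using v sub(2) unfolding subgraph_def by blast
    have "vdegree G1 v + vdegree G3 v = 1" using deg[OF vG] d2[OF v] by simp
    moreover have "card (?I G1 v \<union> ?I G3 v) = card (?I G1 v) + card (?I G3 v)"
      using fin sub disj by (intro card_Un_disjoint) auto
    ultimately have "card (?I G1 v \<union> ?I G3 v) = 1" unfolding vdegree_def by simp
    then obtain a where "?I G1 v \<union> ?I G3 v = {a}" by (meson card_1_singletonE)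
    then have "e \<in> edges G1 \<union> edges G3 \<and> v \<in> e \<longleftrightarrow> e = a" for e by blast
    then show ?thesis by blast
  qed
  then obtain ow where ow: "\<And>v e. v \<in> verts G2 \<Longrightarrow> e \<in> edges G1 \<union> edges G3 \<and> v \<in> e \<longleftrightarrow> e = ow v" by metis
  show thesis
  proof (rule that[of ow])
    show "e \<in> edges G1 \<union> edges G3 \<and> v \<in> e \<longleftrightarrow> e = ow v" if "v \<in> verts G2" for v e by (rule ow[OF that])
  next
    fix e assume e: "e \<in> edges G1"
    show "e \<subseteq> verts G2"
    proof
      fix v assume v: "v \<in> e"
      have "v \<in> verts G" using e v sub(1) unfolding subgraph_def simple_graph_def by blast
      moreover have "0 < vdegree G1 v" using e v fin[OF sub(1), of v] unfolding vdegree_def by (auto simp: card_gt_0_iff)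
      \<comment> \<open>The matching contributes one edge and double-stars contribute 0, 1 or 3, so
        a total of three is impossible without the two edges of a cycle.\<close>
      ultimately show "v \<in> verts G2" using deg[of v] d1[of v] out[OF simp(2), of v] d3[of v] out[OF simp(3), of v] by fastforce
    qed
  next
    fix D x assume D: "D \<in> graph_components G3" and x: "x \<in> leaves D"
    then obtain u where u: "D = component G3 u" unfolding graph_components_eq by blast
    have xD: "x \<in> verts D" "vdegree D x = 1" using x unfolding leaves_def by auto
    then have dx: "vdegree G3 x = 1" using vdegree_component[OF simp(3)] unfolding u by metis
    have "x \<in> verts G" using xD(1) sub(3) unfolding u verts_component subgraph_def by auto
    then have x2: "x \<in> verts G2" using deg[of x] d1[of x] out[OF simp(2), of x] dx by fastforce
    obtain e where e: "?I G3 x = {e}" using dx unfolding vdegree_def by (meson card_1_singletonE)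
    then have "e = ow x" using ow[OF x2, of e] by blast
    moreover have "e \<in> edges D"
      using incident_edges_component[OF simp(3), of x u] xD(1) e unfolding u by blast
    ultimately show "x \<in> verts G2 \<and> ow x \<in> edges D" using x2 by simp
  next
    fix v assume v: "v \<in> verts G2" "ow v \<in> edges G3"
    have vo: "v \<in> ow v" using ow[OF v(1)] by blast
    then have v3: "v \<in> verts G3" using v(2) simp(3) unfolding simple_graph_def by blast
    have "?I G3 v = {ow v}" using ow[OF v(1)] v(2) by blast
    then have "vdegree G3 v = 1" unfolding vdegree_def by simp
    then show "v \<in> verts G3 \<and> v \<in> leaves (component G3 v)"
      using v3 mem_verts_component[OF v3] vdegree_component[OF simp(3) mem_verts_component[OF v3]]
      unfolding leaves_def by simp
  qed
qed

section \<open>Colouring the matching and the double-stars\<close>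

lemma ex_pair_containing:
  assumes "2 \<le> card X" "a \<in> X" "b \<in> X"
  shows "\<exists>P\<subseteq>X. card P = 2 \<and> a \<in> P \<and> b \<in> P"
proof (cases "a = b")
  case True
  have "\<not> X \<subseteq> {a}" using assms(1) card_mono[of "{a}" X] by auto
  then obtain c where "c \<in> X" "c \<noteq> a" by blast
  then show ?thesis using True assms by (intro exI[of _ "{a, c}"]) auto
next
  case False
  then show ?thesis using assms by (intro exI[of _ "{a, b}"]) auto
qed

text \<open>The order is: late leaves and their prescribed colours, one colour
  \<open>\<sigma> v\<close> per cycle vertex, matching edges containing the colours of their ends,
  candidate sets of the late leaves, and finally the double-stars. Conflicts can occur only inside a
  double-star, since the ends of a matching edge meet no other edge off the cycles.\<close>

lemma choice_off_cycles:
  fixes L :: "'a set \<Rightarrow> 'c set"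
  assumes MED: "MED_decomposition G G1 G2 G3"
    and L: "\<And>e. e \<in> edges G \<Longrightarrow> card (L e) = 7"
    and ow: "\<And>v e. v \<in> verts G2 \<Longrightarrow> e \<in> edges G1 \<union> edges G3 \<and> v \<in> e \<longleftrightarrow> e = ow v"
    and E1: "\<And>e. e \<in> edges G1 \<Longrightarrow> e \<subseteq> verts G2"
    and lv: "\<And>D x. D \<in> graph_components G3 \<Longrightarrow> x \<in> leaves D \<Longrightarrow> x \<in> verts G2 \<and> ow x \<in> edges D"
    and E3: "\<And>v. v \<in> verts G2 \<Longrightarrow> ow v \<in> edges G3 \<Longrightarrow> v \<in> verts G3 \<and> v \<in> leaves (component G3 v)"
  obtains f where "\<And>e. e \<in> edges G1 \<union> edges G3 \<Longrightarrow> f e \<subseteq> L e \<and> card (f e) = 2"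
    "\<And>e e'. e \<in> edges G1 \<union> edges G3 \<Longrightarrow> e' \<in> edges G1 \<union> edges G3 \<Longrightarrow> e \<noteq> e' \<Longrightarrow> e \<inter> e' \<noteq> {} \<Longrightarrow> f e \<inter> f e' = {}"
    "\<And>v w. {v, w} \<in> edges G2 \<Longrightarrow> \<exists>c\<in>f (ow v). \<exists>d\<in>f (ow w). compat (L {v, w}) c d"
proof -
  have sub: "subgraph G1 G" "subgraph G2 G" "subgraph G3 G"
    and disj: "edges G1 \<inter> edges G3 = {}"
    and mat: "is_matching G1" and cyc: "\<And>K. K \<in> graph_components G2 \<Longrightarrow> is_cycle K"
    and ds: "\<And>D. D \<in> graph_components G3 \<Longrightarrow> double_star D"
    and ind: "independent_set G (\<Union>D\<in>graph_components G3. leaves D)"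
    using MED unfolding MED_decomposition_def independent_double_stars_def even_cycle_def by blast+
  have simp: "simple_graph G1" "simple_graph G2" "simple_graph G3" using sub unfolding subgraph_def by blast+
  have EG: "e \<in> edges G" if "e \<in> edges G1 \<or> e \<in> edges G2 \<or> e \<in> edges G3" for e
    using that sub unfolding subgraph_def by blast
  have ow13: "ow v \<in> edges G1 \<or> ow v \<in> edges G3" "v \<in> ow v" if "v \<in> verts G2" for v
    using ow[OF that, of "ow v"] by blast+
  have Low: "card (L (ow v)) = 7" if "v \<in> verts G2" for v
    using L[OF EG] ow13(1)[OF that] by blast
  have ends: "v \<in> verts G2" "w \<in> verts G2" if "{v, w} \<in> edges G2" for v w
    using that simp(2) unfolding simple_graph_def by blast+
  have leaf_comp: "component G3 x = D" if "D \<in> graph_components G3" "x \<in> verts D" for D x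
    using that component_eq_of_mem unfolding graph_components_eq by fastforce

  define R where "R D T s Fa Fb f \<longleftrightarrow> (\<forall>e\<in>edges D. f e \<subseteq> L e \<and> card (f e) = 2) \<and>
          (\<forall>e\<in>edges D. \<forall>e'\<in>edges D. e \<noteq> e' \<longrightarrow> e \<inter> e' \<noteq> {} \<longrightarrow> f e \<inter> f e' = {}) \<and>
          (\<forall>x\<in>leaves D - T. s x \<in> f (ow x)) \<and>
          (\<forall>x\<in>T. f (ow x) \<inter> Fa x \<noteq> {} \<and> f (ow x) \<inter> Fb x \<noteq> {})"
    for D T and s :: "'a \<Rightarrow> 'c" and Fa Fb f
  define Q where "Q D T r \<longleftrightarrow> T \<subseteq> leaves D \<and> (\<forall>x\<in>T. r x \<in> L (ow x)) \<and>
    (\<forall>s Fa Fb. (\<forall>x\<in>leaves D - T. s x \<in> L (ow x)) \<longrightarrow>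
       (\<forall>x\<in>T. Fa x \<subseteq> L (ow x) \<and> Fb x \<subseteq> L (ow x) \<and> 2 \<le> card (Fa x) \<and> 2 \<le> card (Fb x) \<and> r x \<in> Fb x) \<longrightarrow>
       (\<exists>f. R D T s Fa Fb f))" for D T r
  have "\<exists>T r. Q D T r" if D: "D \<in> graph_components G3" for D
    unfolding Q_def R_def
  proof (rule double_star_choice[OF ds[OF D]])
    obtain u where u: "D = component G3 u" using D unfolding graph_components_eq by blast
    show "card (L e) = 7" if "e \<in> edges D" for e
      using L[OF EG] that unfolding u edges_component by simp
    show "ow x \<in> edges D \<and> x \<in> ow x" if "x \<in> leaves D" for x
      using lv[OF D that] ow13(2) by blast
  qed
  then obtain TT rr where TT: "\<And>D. D \<in> graph_components G3 \<Longrightarrow> Q D (TT D) (rr D)" by metis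
  define T where "T = {x \<in> verts G3. x \<in> TT (component G3 x)}"
  define r where "r x = rr (component G3 x) x" for x
  have T_leaf: "x \<in> leaves (component G3 x)" "component G3 x \<in> graph_components G3" "x \<in> verts G2"
    "r x \<in> L (ow x)" if "x \<in> T" for x
  proof -
    show c: "component G3 x \<in> graph_components G3" using that component_in[of x G3] unfolding T_def by blast
    show x: "x \<in> leaves (component G3 x)" using TT[OF c] that unfolding T_def Q_def by blast
    show "x \<in> verts G2" using lv[OF c x] by blast
    show "r x \<in> L (ow x)" using TT[OF c] that unfolding T_def r_def Q_def by blast
  qed
  \<comment> \<open>Here independence of the leaves enters: a cycle neighbour of a late leaf is no
    leaf, so its edge off the cycle is in the matching and is coloured before the late leaf.\<close>
  have not_leaf: "ow w \<in> edges G1" if "x \<in> T" "{x, w} \<in> edges G2" for x w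
  proof (rule ccontr)
    assume "ow w \<notin> edges G1"
    then have "ow w \<in> edges G3" using ow13(1)[OF ends(2)[OF that(2)]] by blast
    then have "w \<in> verts G3 \<and> w \<in> leaves (component G3 w)" by (rule E3[OF ends(2)[OF that(2)]])
    then have "w \<in> (\<Union>D\<in>graph_components G3. leaves D)" using component_in[of w G3] by blast
    moreover have "x \<in> (\<Union>D\<in>graph_components G3. leaves D)" using T_leaf(1,2)[OF that(1)] by blast
    moreover have "{x, w} \<in> edges G" using that(2) EG by blast
    ultimately show False using ind unfolding independent_set_def by blast
  qed
  have T_ow: "ow x \<in> edges G3" if "x \<in> T" for x
    using lv[OF T_leaf(2)[OF that] T_leaf(1)[OF that]] unfolding edges_component by blast

  obtain \<sigma> where \<sigma>1: "\<And>v. v \<in> verts G2 \<Longrightarrow> \<sigma> v \<in> L (ow v)"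
    and \<sigma>2: "\<And>v w. {v, w} \<in> edges G2 \<Longrightarrow> v \<notin> T \<Longrightarrow> w \<notin> T \<Longrightarrow> compat (L {v, w}) (\<sigma> v) (\<sigma> w)"
    and \<sigma>3: "\<And>v. v \<in> verts G2 \<Longrightarrow> v \<in> T \<Longrightarrow> \<sigma> v = r v"
    and \<sigma>4: "\<And>v. v \<in> verts G2 \<Longrightarrow> v \<in> T \<Longrightarrow> \<exists>w. {v, w} \<in> edges G2 \<and> compat (L {v, w}) (\<sigma> v) (\<sigma> w)"
  proof (rule slots_on_cycles[OF simp(2) cyc, of 7 "\<lambda>v. L (ow v)" L T r])
    show "w \<notin> T" if "{v, w} \<in> edges G2" "v \<in> T" for v w
      using not_leaf[OF that(2,1)] T_ow[of w] disj by blast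
    show "card (L e) = 7" if "e \<in> edges G2" for e using L[OF EG] that by blast
  qed (use Low T_leaf(4) that in auto)

  have "\<exists>P\<subseteq>L e. card P = 2 \<and> (\<forall>v\<in>e. \<sigma> v \<in> P)" if e: "e \<in> edges G1" for e
  proof -
    have "card e = 2" using e simp(1) unfolding simple_graph_def by blast
    then obtain a b where ab: "e = {a, b}" by (meson card_2_iff)
    then have in_e: "a \<in> e" "b \<in> e" by simp_all
    then have v: "a \<in> verts G2" "b \<in> verts G2" using E1[OF e] by blast+
    then have "e = ow a" "e = ow b" using ow[of a e] ow[of b e] e in_e by blast+
    then have \<sigma>e: "\<sigma> a \<in> L e" "\<sigma> b \<in> L e" using \<sigma>1[OF v(1)] \<sigma>1[OF v(2)] by simp_all
    have "card (L e) = 7" using L[OF EG] e by blast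
    then have "2 \<le> card (L e)" by simp
    from ex_pair_containing[OF this \<sigma>e] show ?thesis unfolding ab by auto
  qed
  then obtain f1 where f1: "\<And>e. e \<in> edges G1 \<Longrightarrow> f1 e \<subseteq> L e \<and> card (f1 e) = 2 \<and> (\<forall>v\<in>e. \<sigma> v \<in> f1 e)"
    by metis

  \<comment> \<open>The colours at the late leaf \<open>x\<close> that make the cycle edge towards
    \<open>w\<close> lose at most three colours, once the matching edge at \<open>w\<close> has its
    pair.\<close>
  define F where "F x w = {c \<in> L (ow x). \<exists>d\<in>f1 (ow w). compat (L {x, w}) c d}" for x w
  have F: "2 \<le> card (F x w)" if "x \<in> T" "{x, w} \<in> edges G2" for x w
  proof -
    have c: "card (L (ow x)) = 7" "card (L {x, w}) = 7" "card (f1 (ow w)) = 2"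
      using Low[OF T_leaf(3)[OF that(1)]] L[OF EG] that(2) f1[OF not_leaf[OF that]] by blast+
    then have "finite (L (ow x))" "finite (L {x, w})" by (metis card.infinite zero_neq_numeral)+
    then show ?thesis using card_compat_ge[of "L {x, w}" "L (ow x)" "f1 (ow w)"] c unfolding F_def by simp
  qed
  \<comment> \<open>The two cycle neighbours are named so that \<open>b\<close> is one towards which
    the colour \<open>\<sigma> x\<close> is compatible.\<close>
  have "\<exists>a b. (\<forall>w. {x, w} \<in> edges G2 \<longleftrightarrow> w = a \<or> w = b) \<and> compat (L {x, b}) (\<sigma> x) (\<sigma> b)" if x: "x \<in> T" for x
  proof -
    note x2 = T_leaf(3)[OF x]
    obtain b where b: "{x, b} \<in> edges G2" "compat (L {x, b}) (\<sigma> x) (\<sigma> b)" using \<sigma>4[OF x2 x] by blast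
    have "vdegree G2 x = 2"
      using vdegree_cycle[of "component G2 x" x] cyc[OF component_in[OF x2]] mem_verts_component[OF x2]
        vdegree_component[OF simp(2) mem_verts_component[OF x2]] by simp
    then have "card {w. {x, w} \<in> edges G2} = 2" using vdegree_eq_card_neighbours[OF simp(2)] by simp
    then obtain c d where cd: "{w. {x, w} \<in> edges G2} = {c, d}" by (meson card_2_iff)
    then have "b \<in> {c, d}" using b(1) by blast
    then obtain a where "{c, d} = {a, b}" by blast
    then have "{x, w} \<in> edges G2 \<longleftrightarrow> w = a \<or> w = b" for w using cd by blast
    then show ?thesis using b(2) by blast
  qed
  then obtain wa wb where wab: "\<And>x w. x \<in> T \<Longrightarrow> {x, w} \<in> edges G2 \<longleftrightarrow> w = wa x \<or> w = wb x"
    and wb: "\<And>x. x \<in> T \<Longrightarrow> compat (L {x, wb x}) (\<sigma> x) (\<sigma> (wb x))" by metis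
  \<comment> \<open>The propagation kept the prescribed colour compatible with the colour at
    \<open>wb x\<close>, which the matching edge there contains. So committing to \<open>r x\<close>
    would satisfy this cycle edge.\<close>
  have rF: "r x \<in> F x (wb x)" if x: "x \<in> T" for x
  proof -
    have e: "{x, wb x} \<in> edges G2" using wab[OF x] by blast
    have "\<sigma> (wb x) \<in> f1 (ow (wb x))" using f1[OF not_leaf[OF x e]] ow13(2)[OF ends(2)[OF e]] by blast
    then show ?thesis
      using wb[OF x] T_leaf(4)[OF x] \<sigma>3[OF T_leaf(3)[OF x] x] unfolding F_def by auto
  qed

  have "\<exists>f. R D (TT D) \<sigma> (\<lambda>x. F x (wa x)) (\<lambda>x. F x (wb x)) f" if D: "D \<in> graph_components G3" for D
  proof -
    have Q: "Q D (TT D) (rr D)" by (rule TT[OF D])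
    have inT: "x \<in> T" "rr D x = r x" if "x \<in> TT D" for x
    proof -
      have "x \<in> leaves D" using Q that unfolding Q_def by blast
      then have x: "x \<in> verts D" unfolding leaves_def by blast
      then have c: "component G3 x = D" by (rule leaf_comp[OF D])
      have "x \<in> verts G3" using D x unfolding graph_components_eq by (auto simp: verts_component)
      then show "x \<in> T" "rr D x = r x" using that c unfolding T_def r_def by simp_all
    qed
    have "\<forall>x\<in>leaves D - TT D. \<sigma> x \<in> L (ow x)" using lv[OF D] \<sigma>1 by blast
    moreover have "\<forall>x\<in>TT D. F x (wa x) \<subseteq> L (ow x) \<and> F x (wb x) \<subseteq> L (ow x) \<and>
        2 \<le> card (F x (wa x)) \<and> 2 \<le> card (F x (wb x)) \<and> rr D x \<in> F x (wb x)"
    proof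
      fix x assume x: "x \<in> TT D"
      have "{x, wa x} \<in> edges G2" "{x, wb x} \<in> edges G2" using wab[OF inT(1)[OF x]] by blast+
      then have "2 \<le> card (F x (wa x))" "2 \<le> card (F x (wb x))" using F[OF inT(1)[OF x]] by blast+
      moreover have "F x w \<subseteq> L (ow x)" for w unfolding F_def by blast
      ultimately show "F x (wa x) \<subseteq> L (ow x) \<and> F x (wb x) \<subseteq> L (ow x) \<and>
        2 \<le> card (F x (wa x)) \<and> 2 \<le> card (F x (wb x)) \<and> rr D x \<in> F x (wb x)"
        using rF[OF inT(1)[OF x]] inT(2)[OF x] by simp
    qed
    ultimately show ?thesis
      by (rule Q[unfolded Q_def, THEN conjunct2, THEN conjunct2, THEN spec[of _ \<sigma>],
          THEN spec[of _ "\<lambda>x. F x (wa x)"], THEN spec[of _ "\<lambda>x. F x (wb x)"], THEN mp, THEN mp])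
  qed
  then obtain f3 where f3: "\<And>D. D \<in> graph_components G3 \<Longrightarrow>
      R D (TT D) \<sigma> (\<lambda>x. F x (wa x)) (\<lambda>x. F x (wb x)) (f3 D)" by metis

  \<comment> \<open>Any end of an edge of \<open>G3\<close> lies in the same double-star, so the end
    picked by \<open>SOME\<close> is immaterial.\<close>
  define f where "f e = (if e \<in> edges G1 then f1 e else f3 (component G3 (SOME v. v \<in> e)) e)" for e
  have fE1: "f e = f1 e" if "e \<in> edges G1" for e using that unfolding f_def by simp
  have fE3: "f e = f3 (component G3 v) e" if "e \<in> edges G3" "v \<in> e" for e v
  proof -
    have "e \<notin> edges G1" using that disj by blast
    then show ?thesis
      using component_eq_of_edge[OF simp(3) that(1) someI[of "\<lambda>v. v \<in> e", OF that(2)] that(2)]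
      unfolding f_def by simp
  qed
  have comp3: "component G3 v \<in> graph_components G3" "e \<in> edges (component G3 v)"
    if "e \<in> edges G3" "v \<in> e" for e v
  proof -
    have "v \<in> verts G3" using that simp(3) unfolding simple_graph_def by blast
    then show "component G3 v \<in> graph_components G3" by (rule component_in)
    show "e \<in> edges (component G3 v)" by (rule edge_in_component[OF simp(3) that])
  qed
  have fT: "\<exists>c\<in>f (ow v). \<exists>d\<in>f (ow w). compat (L {v, w}) c d" if vw: "{v, w} \<in> edges G2" "v \<in> T" for v w
  proof -
    note v2 = T_leaf(3)[OF vw(2)]
    have fv: "f (ow v) = f3 (component G3 v) (ow v)" by (rule fE3[OF T_ow[OF vw(2)] ow13(2)[OF v2]])
    have "v \<in> TT (component G3 v)" using vw(2) unfolding T_def by blast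
    then have "f (ow v) \<inter> F v (wa v) \<noteq> {} \<and> f (ow v) \<inter> F v (wb v) \<noteq> {}"
      unfolding fv using f3[OF T_leaf(2)[OF vw(2)]] unfolding R_def by blast
    moreover have "w = wa v \<or> w = wb v" using wab[OF vw(2)] vw(1) by blast
    ultimately have "f (ow v) \<inter> F v w \<noteq> {}" by blast
    then show ?thesis unfolding fE1[OF not_leaf[OF vw(2,1)]] F_def by blast
  qed
  have fS: "\<sigma> v \<in> f (ow v)" if v: "v \<in> verts G2" "v \<notin> T" for v
  proof (cases "ow v \<in> edges G1")
    case True
    then show ?thesis using fE1[OF True] f1[OF True] ow13(2)[OF v(1)] by blast
  next
    case False
    then have o3: "ow v \<in> edges G3" using ow13(1)[OF v(1)] by blast
    have l: "v \<in> verts G3" "v \<in> leaves (component G3 v)" using E3[OF v(1) o3] by blast+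
    then have "v \<in> leaves (component G3 v) - TT (component G3 v)" using v(2) unfolding T_def by blast
    then show ?thesis
      unfolding fE3[OF o3 ow13(2)[OF v(1)]] using f3[OF component_in[OF l(1)]] unfolding R_def by blast
  qed
  show thesis
  proof (rule that[of f])
    fix e assume e: "e \<in> edges G1 \<union> edges G3"
    show "f e \<subseteq> L e \<and> card (f e) = 2"
    proof (cases "e \<in> edges G1")
      case True
      then show ?thesis using fE1 f1 by simp
    next
      case False
      then have e3: "e \<in> edges G3" using e by blast
      then have "card e = 2" using simp(3) unfolding simple_graph_def by blast
      then obtain v where v: "v \<in> e" by fastforce
      show ?thesis unfolding fE3[OF e3 v] using f3[OF comp3(1)[OF e3 v]] comp3(2)[OF e3 v] unfolding R_def by blast
    qed
  next
    fix e e' assume e: "e \<in> edges G1 \<union> edges G3" "e' \<in> edges G1 \<union> edges G3" "e \<noteq> e'" "e \<inter> e' \<noteq> {}"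
    then obtain v where v: "v \<in> e" "v \<in> e'" by blast
    \<comment> \<open>A matching edge has both ends on cycles, and a cycle vertex is on just one
      edge off the cycles, so neither of two distinct incident edges is in the matching.\<close>
    have "\<not> (a \<in> edges G1)" if "a = e \<or> a = e'" for a
    proof
      assume "a \<in> edges G1"
      then have "v \<in> verts G2" using E1 that v by blast
      then have "e = ow v" "e' = ow v" using ow[of v e] ow[of v e'] e v by blast+
      then show False using e(3) by simp
    qed
    then have e3: "e \<in> edges G3" "e' \<in> edges G3" using e by blast+
    show "f e \<inter> f e' = {}"
      unfolding fE3[OF e3(1) v(1)] fE3[OF e3(2) v(2)]
      using f3[OF comp3(1)[OF e3(1) v(1)]] comp3(2)[OF e3(1) v(1)] comp3(2)[OF e3(2) v(2)] e(3,4) unfolding R_def by blast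
  next
    fix v w assume vw: "{v, w} \<in> edges G2"
    show "\<exists>c\<in>f (ow v). \<exists>d\<in>f (ow w). compat (L {v, w}) c d"
    proof -
      consider "v \<in> T" | "w \<in> T" | "v \<notin> T" "w \<notin> T" by blast
      then show ?thesis
      proof cases
        case 1
        then show ?thesis using fT[OF vw] by blast
      next
        case 2
        have "{w, v} \<in> edges G2" using vw by (simp only: insert_commute)
        then have "\<exists>c\<in>f (ow w). \<exists>d\<in>f (ow v). compat (L {w, v}) c d" using fT 2 by blast
        then show ?thesis using compat_sym by (metis insert_commute)
      next
        case 3
        then show ?thesis using fS[OF ends(1)[OF vw]] fS[OF ends(2)[OF vw]] \<sigma>2[OF vw] by blast
      qed
    qed
  qed
qed

section \<open>Completing the colouring along the even cycles\<close>

theorem theorem2: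
  fixes G :: "'a graph"
  assumes "simple_graph G"
    and "regular_graph 3 G"
    and "\<exists>G1 G2 G3. MED_decomposition G G1 G2 G3"
  shows "edge_choosable TYPE('c) 7 2 G"
  unfolding edge_choosable_def
proof (intro allI impI)
  fix L :: "'a set \<Rightarrow> 'c set"
  assume "\<forall>e\<in>edges G. finite (L e) \<and> card (L e) = 7"
  then have L: "\<And>e. e \<in> edges G \<Longrightarrow> card (L e) = 7" and Lfin: "\<And>e. e \<in> edges G \<Longrightarrow> finite (L e)" by blast+
  obtain G1 G2 G3 where MED: "MED_decomposition G G1 G2 G3" using assms(3) by blast
  have E: "edges G = (edges G1 \<union> edges G3) \<union> edges G2"
    and disj: "edges G1 \<inter> edges G2 = {}" "edges G2 \<inter> edges G3 = {}"
    and G2: "simple_graph G2" and cyc: "\<And>K. K \<in> graph_components G2 \<Longrightarrow> even_cycle K"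
    using MED unfolding MED_decomposition_def subgraph_def by blast+
  obtain ow where ow: "\<And>v e. v \<in> verts G2 \<Longrightarrow> e \<in> edges G1 \<union> edges G3 \<and> v \<in> e \<longleftrightarrow> e = ow v"
    and st: "\<And>e. e \<in> edges G1 \<Longrightarrow> e \<subseteq> verts G2"
      "\<And>D x. D \<in> graph_components G3 \<Longrightarrow> x \<in> leaves D \<Longrightarrow> x \<in> verts G2 \<and> ow x \<in> edges D"
      "\<And>v. v \<in> verts G2 \<Longrightarrow> ow v \<in> edges G3 \<Longrightarrow> v \<in> verts G3 \<and> v \<in> leaves (component G3 v)"
    by (rule MED_structure[OF assms(1,2) MED]) blast
  obtain f where f: "\<And>e. e \<in> edges G1 \<union> edges G3 \<Longrightarrow> f e \<subseteq> L e \<and> card (f e) = 2"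
    and fdis: "\<And>e e'. e \<in> edges G1 \<union> edges G3 \<Longrightarrow> e' \<in> edges G1 \<union> edges G3 \<Longrightarrow> e \<noteq> e' \<Longrightarrow> e \<inter> e' \<noteq> {} \<Longrightarrow> f e \<inter> f e' = {}"
    and comp: "\<And>v w. {v, w} \<in> edges G2 \<Longrightarrow> \<exists>c\<in>f (ow v). \<exists>d\<in>f (ow w). compat (L {v, w}) c d"
    by (rule choice_off_cycles[OF MED L ow st]) blast+
  \<comment> \<open>What is left of the list of a cycle edge after the edges off the cycles at its
    ends are coloured; any choice from it avoids conflicts with those edges.\<close>
  define B where "B e = L e - (\<Union>v\<in>e. f (ow v))" for e
  have B: "finite (B e) \<and> 2 * 2 \<le> card (B e)" if e: "e \<in> edges G2" for e
  proof -
    have "card e = 2" "e \<subseteq> verts G2" using e G2 unfolding simple_graph_def by blast+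
    then obtain v w where vw: "e = {v, w}" "v \<in> verts G2" "w \<in> verts G2" by (auto simp: card_2_iff)
    have eG: "e \<in> edges G" using e E by blast
    obtain c d where "c \<in> f (ow v)" "d \<in> f (ow w)" "compat (L e) c d" using comp e vw(1) by blast
    moreover have "card (f (ow v)) = 2" "card (f (ow w)) = 2"
      using f ow[OF vw(2), of "ow v"] ow[OF vw(3), of "ow w"] by blast+
    ultimately have "4 \<le> card (L e - (f (ow v) \<union> f (ow w)))" using card_remaining_ge_4[OF L[OF eG]] by blast
    then show ?thesis using Lfin[OF eG] unfolding B_def vw(1) by simp
  qed
  obtain g where g: "\<And>e. e \<in> edges G2 \<Longrightarrow> g e \<subseteq> B e \<and> card (g e) = 2"
    and gdis: "\<And>e e'. e \<in> edges G2 \<Longrightarrow> e' \<in> edges G2 \<Longrightarrow> e \<noteq> e' \<Longrightarrow> e \<inter> e' \<noteq> {} \<Longrightarrow> g e \<inter> g e' = {}"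
    by (rule choice_on_even_cycles[OF G2 cyc B]) blast+
  have gf: "g e \<inter> f e' = {}" if e: "e \<in> edges G2" "e' \<in> edges G1 \<union> edges G3" "e \<inter> e' \<noteq> {}" for e e'
  proof -
    obtain v where v: "v \<in> e" "v \<in> e'" using e(3) by blast
    then have "v \<in> verts G2" using e(1) G2 unfolding simple_graph_def by blast
    then have "e' = ow v" using ow[of v e'] e(2) v(2) by blast
    then show ?thesis using g[OF e(1)] v(1) unfolding B_def by blast
  qed
  define h where "h e = (if e \<in> edges G2 then g e else f e)" for e
  have h2: "h e = g e" if "e \<in> edges G2" for e using that unfolding h_def by simp
  have h13: "h e = f e" if "e \<in> edges G1 \<union> edges G3" for e using that disj unfolding h_def by auto
  show "\<exists>f. (\<forall>e\<in>edges G. f e \<subseteq> L e \<and> card (f e) = 2) \<and>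
      (\<forall>e\<in>edges G. \<forall>e'\<in>edges G. e \<noteq> e' \<and> e \<inter> e' \<noteq> {} \<longrightarrow> f e \<inter> f e' = {})"
  proof (intro exI[of _ h] conjI ballI impI)
    fix e assume e: "e \<in> edges G"
    show "h e \<subseteq> L e"
      using e h2[of e] h13[of e] f[of e] g[of e] unfolding E B_def by blast
    show "card (h e) = 2" using e h2[of e] h13[of e] f[of e] g[of e] unfolding E by auto
  next
    fix e e' assume e: "e \<in> edges G" "e' \<in> edges G" and ne: "e \<noteq> e' \<and> e \<inter> e' \<noteq> {}"
    consider "e \<in> edges G2" "e' \<in> edges G2" | "e \<in> edges G2" "e' \<in> edges G1 \<union> edges G3"
      | "e' \<in> edges G2" "e \<in> edges G1 \<union> edges G3" | "e \<in> edges G1 \<union> edges G3" "e' \<in> edges G1 \<union> edges G3"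
      using e unfolding E by blast
    then show "h e \<inter> h e' = {}"
    proof cases
      case 1
      then show ?thesis using gdis ne h2 by simp
    next
      case 2
      then show ?thesis using gf[of e e'] ne h2 h13 by simp
    next
      case 3
      then show ?thesis using gf[of e' e] ne h2[of e'] h13[of e] by blast
    next
      case 4
      then show ?thesis using fdis ne h13 by simp
    qed
  qed
qed

end
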